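(* Let $F : C \to D$ be a discrete Conduché $\omega$-functor between $\omega$-categories. (1) If $D$ is free, then so is $C$. (2) If $C$ is free and if $F_n : C_n \to D_n$ is surjective for every $n \in \mathbb{N}$, then $D$ is also free.
   Context: $\omega$-categories. An $\omega$-category means a small strict globular $\omega$-category $C$: sets $C_n$ of $n$-cells ($n\ge 0$), source and target maps $s,t : C_{n+1}\to C_n$ with $ss=st$, $tt=ts$ (iterated to $s_k,t_k : C_n \to C_k$ for $k<n$), units $x\mapsto 1_x : C_n \to C_{n+1}$ (iterated to $1^n_x\in C_n$ for a $k$-cell $x$, $k\le n$), and compositions $x *_k y$ of $n$-cells $x,y$ with $s_k(x)=t_k(y)$ (such a pair is called $k$-composable), $0\le k<n$, satisfying the usual source/target, unit, functoriality of units, associativity and exchange axioms. $\omega$-functors $F=(F_n)_n$ are the maps preserving all this structure; $\omega\mathbf{Cat}$ is the resulting category. Two $n$-cells are parallel if $n=0$ or they have the same source and the same target. Free $\omega$-categories. $\mathbb{D}_n$ (the $n$-globe) is the $\omega$-category with one non-unit $n$-cell $e_n$ and exactly two parallel non-unit $k$-cells $s_k(e_n),t_k(e_n)$ for each $k<n$ and no other non-unit cells; it represents $C\mapsto C_n$, and $\langle x\rangle:\mathbb{D}_n\to C$ is the $\omega$-functor corresponding to $x \in C_n$. For an $\omega$-category $C$, $\mathrm{sk}_n(C)$ is the sub-$\omega$-category with the same $k$-cells as $C$ for $k\le n$ and only unit cells in dimension $>n$ ($\mathrm{sk}_{-1}(C)=\emptyset$). Put $\mathbb{S}_{n-1}=\mathrm{sk}_{n-1}(\mathbb{D}_n)$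 (with $\mathbb{S}_{-1}=\emptyset$), with inclusion $i_n : \mathbb{S}_{n-1}\to\mathbb{D}_n$; for $n\geq 1$, $\omega$-functors $\langle x,y\rangle : \mathbb{S}_{n-1}\to C$ correspond to pairs $(x,y)$ of parallel $(n-1)$-cells. A subset $E\subseteq C_n$ is an $n$-basis of $C$ if the square with top map $(\langle s(x),t(x)\rangle)_{x\in E} : \coprod_{x\in E}\mathbb{S}_{n-1}\to \mathrm{sk}_{n-1}(C)$, left map $\coprod_{x \in E} i_n$, right map the inclusion $\mathrm{sk}_{n-1}(C)\hookrightarrow\mathrm{sk}_n(C)$ and bottom map $(\langle x\rangle)_{x\in E} : \coprod_{x\in E}\mathbb{D}_n\to\mathrm{sk}_n(C)$ is cocartesian in $\omega\mathbf{Cat}$. $C$ is free if it has an $n$-basis for every $n\ge 0$. Discrete Conduché $\omega$-functors. An $\omega$-functor $F:C\to D$ is discrete Conduché if for all $0\le k<n$: (i) for every $n$-cell $x$ of $C$ and every $k$-cell $y$ of $D$ with $F(x)=1^n_y$, there is a unique $k$-cell $z$ of $C$ with $x=1^n_z$ and $F(z)=y$; (ii) for every $n$-cell $x$ of $C$ and every $k$-composable pair $(y',y'')$ of $n$-cells of $D$ with $F(x)=y'*_k y''$, there is a unique $k$-composable pair $(x',x'')$ of $n$-cells of $C$ with $x=x'*_k x''$, $F(x')=y'$ and $F(x'')=y''$. *)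

theory Defs
  imports Main
begin

section \<open>Strict globular omega-categories\<close>

text \<open>
  The \<open>n\<close>-cells of \<open>C\<close> are the elements of \<open>cells C n\<close>; sets of cells of different dimensions
  need not be disjoint. The operations are indexed by dimension: \<open>src C n\<close> and \<open>tgt C n\<close> go from
  \<open>n+1\<close>-cells to \<open>n\<close>-cells, \<open>unit C n\<close> from \<open>n\<close>-cells to \<open>n+1\<close>-cells, and \<open>composite C n k x y\<close> is
  the composite \<open>x *\<^sub>k y\<close> of two \<open>n\<close>-cells. Their values outside the cells are irrelevant.
\<close>

record 'a ocat =
  cells :: "nat \<Rightarrow> 'a set"
  src :: "nat \<Rightarrow> 'a \<Rightarrow> 'a"
  tgt :: "nat \<Rightarrow> 'a \<Rightarrow> 'a"
  unit :: "nat \<Rightarrow> 'a \<Rightarrow> 'a"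
  composite :: "nat \<Rightarrow> nat \<Rightarrow> 'a \<Rightarrow> 'a \<Rightarrow> 'a"

text \<open>
  For \<open>k \<le> n\<close>, \<open>src_to C n k\<close> and \<open>tgt_to C n k\<close> are the iterated source and target from
  \<open>n\<close>-cells to \<open>k\<close>-cells, and \<open>unit_to C k n\<close> is the iterated unit from \<open>k\<close>-cells to \<open>n\<close>-cells
  (each the identity for \<open>k = n\<close>).
\<close>

primrec src_to :: "'a ocat \<Rightarrow> nat \<Rightarrow> nat \<Rightarrow> 'a \<Rightarrow> 'a" where
  "src_to C 0 k x = x"
| "src_to C (Suc n) k x = (if k \<le> n then src_to C n k (src C n x) else x)"

primrec tgt_to :: "'a ocat \<Rightarrow> nat \<Rightarrow> nat \<Rightarrow> 'a \<Rightarrow> 'a" where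
  "tgt_to C 0 k x = x"
| "tgt_to C (Suc n) k x = (if k \<le> n then tgt_to C n k (tgt C n x) else x)"

primrec unit_to :: "'a ocat \<Rightarrow> nat \<Rightarrow> nat \<Rightarrow> 'a \<Rightarrow> 'a" where
  "unit_to C k 0 x = x"
| "unit_to C k (Suc n) x = (if k \<le> n then unit C n (unit_to C k n x) else x)"

definition composable :: "'a ocat \<Rightarrow> nat \<Rightarrow> nat \<Rightarrow> 'a \<Rightarrow> 'a \<Rightarrow> bool" where
  "composable C n k x y \<longleftrightarrow>
     k < n \<and> x \<in> cells C n \<and> y \<in> cells C n \<and> src_to C n k x = tgt_to C n k y"

locale omega_category =
  fixes C :: "'a ocat"
  assumes src_cell: "x \<in> cells C (Suc n) \<Longrightarrow> src C n x \<in> cells C n"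
    and tgt_cell: "x \<in> cells C (Suc n) \<Longrightarrow> tgt C n x \<in> cells C n"
    and src_src: "x \<in> cells C (Suc (Suc n)) \<Longrightarrow> src C n (src C (Suc n) x) = src C n (tgt C (Suc n) x)"
    and tgt_tgt: "x \<in> cells C (Suc (Suc n)) \<Longrightarrow> tgt C n (tgt C (Suc n) x) = tgt C n (src C (Suc n) x)"
    and unit_cell: "x \<in> cells C n \<Longrightarrow> unit C n x \<in> cells C (Suc n)"
    and src_unit: "x \<in> cells C n \<Longrightarrow> src C n (unit C n x) = x"
    and tgt_unit: "x \<in> cells C n \<Longrightarrow> tgt C n (unit C n x) = x"
    and comp_cell: "composable C n k x y \<Longrightarrow> composite C n k x y \<in> cells C n"
    and src_comp_top: "composable C (Suc n) n x y \<Longrightarrow> src C n (composite C (Suc n) n x y) = src C n y"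
    and tgt_comp_top: "composable C (Suc n) n x y \<Longrightarrow> tgt C n (composite C (Suc n) n x y) = tgt C n x"
    and src_comp: "composable C (Suc n) k x y \<Longrightarrow> k < n \<Longrightarrow>
          src C n (composite C (Suc n) k x y) = composite C n k (src C n x) (src C n y)"
    and tgt_comp: "composable C (Suc n) k x y \<Longrightarrow> k < n \<Longrightarrow>
          tgt C n (composite C (Suc n) k x y) = composite C n k (tgt C n x) (tgt C n y)"
    and unit_left: "x \<in> cells C n \<Longrightarrow> k < n \<Longrightarrow> composite C n k (unit_to C k n (tgt_to C n k x)) x = x"
    and unit_right: "x \<in> cells C n \<Longrightarrow> k < n \<Longrightarrow> composite C n k x (unit_to C k n (src_to C n k x)) = x"
    and unit_comp: "composable C n k x y \<Longrightarrow>
          unit C n (composite C n k x y) = composite C (Suc n) k (unit C n x) (unit C n y)"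
    and assoc: "composable C n k x y \<Longrightarrow> composable C n k y z \<Longrightarrow>
          composite C n k (composite C n k x y) z = composite C n k x (composite C n k y z)"
    and exchange: "l < k \<Longrightarrow> composable C n k x x' \<Longrightarrow> composable C n k y y' \<Longrightarrow>
          composable C n l x y \<Longrightarrow> composable C n l x' y' \<Longrightarrow>
          composite C n l (composite C n k x x') (composite C n k y y') =
          composite C n k (composite C n l x y) (composite C n l x' y')"

locale omega_functor = dom: omega_category A + cod: omega_category B
  for A :: "'a ocat" and B :: "'b ocat" +
  fixes F :: "nat \<Rightarrow> 'a \<Rightarrow> 'b"
  assumes map_cell: "x \<in> cells A n \<Longrightarrow> F n x \<in> cells B n"
    and map_src: "x \<in> cells A (Suc n) \<Longrightarrow> F n (src A n x) = src B n (F (Suc n) x)"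
    and map_tgt: "x \<in> cells A (Suc n) \<Longrightarrow> F n (tgt A n x) = tgt B n (F (Suc n) x)"
    and map_unit: "x \<in> cells A n \<Longrightarrow> F (Suc n) (unit A n x) = unit B n (F n x)"
    and map_comp: "composable A n k x y \<Longrightarrow> F n (composite A n k x y) = composite B n k (F n x) (F n y)"


section \<open>Cocartesian squares\<close>

text \<open>
  The square with top \<open>f : A \<rightarrow> B\<close>, left \<open>g : A \<rightarrow> B'\<close>, right \<open>u : B \<rightarrow> P\<close>, bottom \<open>v : B' \<rightarrow> P\<close>
  has the universal property of a pushout with respect to all omega-categories
  with cells in \<open>'t\<close>. Functors are compared on cells only.
\<close>

definition cocartesian_for :: "'t itself \<Rightarrow> 'a ocat \<Rightarrow> 'b ocat \<Rightarrow> 'c ocat \<Rightarrow> 'p ocat \<Rightarrow>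
    (nat \<Rightarrow> 'a \<Rightarrow> 'b) \<Rightarrow> (nat \<Rightarrow> 'a \<Rightarrow> 'c) \<Rightarrow> (nat \<Rightarrow> 'b \<Rightarrow> 'p) \<Rightarrow> (nat \<Rightarrow> 'c \<Rightarrow> 'p) \<Rightarrow> bool" where
  "cocartesian_for (_ :: 't itself) A B B' P f g u v \<longleftrightarrow>
     omega_functor A B f \<and> omega_functor A B' g \<and> omega_functor B P u \<and> omega_functor B' P v \<and>
     (\<forall>n. \<forall>x\<in>cells A n. u n (f n x) = v n (g n x)) \<and>
     (\<forall>(T :: 't ocat) p q.
        omega_functor B T p \<and> omega_functor B' T q \<and>
        (\<forall>n. \<forall>x\<in>cells A n. p n (f n x) = q n (g n x)) \<longrightarrow>
        (\<exists>h. omega_functor P T h \<and>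
             (\<forall>n. \<forall>y\<in>cells B n. h n (u n y) = p n y) \<and>
             (\<forall>n. \<forall>z\<in>cells B' n. h n (v n z) = q n z) \<and>
             (\<forall>h'. omega_functor P T h' \<and>
                   (\<forall>n. \<forall>y\<in>cells B n. h' n (u n y) = p n y) \<and>
                   (\<forall>n. \<forall>z\<in>cells B' n. h' n (v n z) = q n z) \<longrightarrow>
                   (\<forall>n. \<forall>w\<in>cells P n. h' n w = h n w))))"

text \<open>
  HOL cannot quantify over the type \<open>'t\<close> inside a definition. Lists over \<open>nat + ('b + 'c + 'p)\<close>
  are large enough to test against: lemma \<open>cocartesian_all_types\<close> below derives the
  universal property with respect to omega-categories with cells in an arbitrary type.
\<close>

definition cocartesian :: "'a ocat \<Rightarrow> 'b ocat \<Rightarrow> 'c ocat \<Rightarrow> 'p ocat \<Rightarrow>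
    (nat \<Rightarrow> 'a \<Rightarrow> 'b) \<Rightarrow> (nat \<Rightarrow> 'a \<Rightarrow> 'c) \<Rightarrow> (nat \<Rightarrow> 'b \<Rightarrow> 'p) \<Rightarrow> (nat \<Rightarrow> 'c \<Rightarrow> 'p) \<Rightarrow> bool" where
  "cocartesian (A :: 'a ocat) (B :: 'b ocat) (B' :: 'c ocat) (P :: 'p ocat) f g u v \<longleftrightarrow>
     cocartesian_for TYPE((nat + ('b + 'c + 'p)) list) A B B' P f g u v"


section \<open>Globes, skeleta, bases and free omega-categories\<close>

text \<open>
  In the \<open>n\<close>-globe, \<open>(j, False)\<close> and \<open>(j, True)\<close> for \<open>j < n\<close> are the \<open>j\<close>-dimensional source and
  target of the principal cell \<open>e\<^sub>n = (n, True)\<close>. Each of them also stands for its iterated units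
  in higher dimensions, so that units are identities.
\<close>

definition globe :: "nat \<Rightarrow> (nat \<times> bool) ocat" where
  "globe n =
     \<lparr>cells = (\<lambda>m. {(j, b). j \<le> m \<and> (j < n \<or> j = n \<and> b)}),
      src = (\<lambda>m c. if fst c \<le> m then c else (m, False)),
      tgt = (\<lambda>m c. if fst c \<le> m then c else (m, True)),
      unit = (\<lambda>m c. c),
      composite = (\<lambda>m k c d. if fst c \<le> k then d else c)\<rparr>"

text \<open>
  \<open>skel m C\<close> is the \<open>(m-1)\<close>-skeleton of \<open>C\<close>: all cells of dimension \<open>< m\<close> and their iterated
  units. In particular \<open>skel 0 C\<close> is empty.
\<close>

definition skel :: "nat \<Rightarrow> 'a ocat \<Rightarrow> 'a ocat" where
  "skel m C = C\<lparr>cells := (\<lambda>n. {unit_to C j n x | j x. j < m \<and> j \<le> n \<and> x \<in> cells C j})\<rparr>"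

text \<open>The coproduct of copies of \<open>G\<close> indexed by \<open>E\<close>.\<close>

definition copies :: "'i set \<Rightarrow> 'a ocat \<Rightarrow> ('i \<times> 'a) ocat" where
  "copies E G =
     \<lparr>cells = (\<lambda>n. E \<times> cells G n),
      src = (\<lambda>n (i, c). (i, src G n c)),
      tgt = (\<lambda>n (i, c). (i, tgt G n c)),
      unit = (\<lambda>n (i, c). (i, unit G n c)),
      composite = (\<lambda>n k (i, c) (j, d). (i, composite G n k c d))\<rparr>"

text \<open>
  \<open>cell_map C n x\<close> is the functor from \<open>globe n\<close> to \<open>C\<close> sending \<open>e\<^sub>n\<close> to the \<open>n\<close>-cell \<open>x\<close>, and
  \<open>pair_map C m x y\<close> is the functor from \<open>skel (m+1) (globe (m+1))\<close> to \<open>C\<close> sending the source and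
  target of \<open>e\<^sub>m\<^sub>+\<^sub>1\<close> to the parallel \<open>m\<close>-cells \<open>x\<close> and \<open>y\<close>.
\<close>

definition cell_map :: "'a ocat \<Rightarrow> nat \<Rightarrow> 'a \<Rightarrow> nat \<Rightarrow> nat \<times> bool \<Rightarrow> 'a" where
  "cell_map C n x k = (\<lambda>(j, b). unit_to C j k (if b then tgt_to C n j x else src_to C n j x))"

definition pair_map :: "'a ocat \<Rightarrow> nat \<Rightarrow> 'a \<Rightarrow> 'a \<Rightarrow> nat \<Rightarrow> nat \<times> bool \<Rightarrow> 'a" where
  "pair_map C m x y k = (\<lambda>(j, b). unit_to C j k (if b then tgt_to C m j y else src_to C m j x))"

text \<open>
  For \<open>n = 0\<close> the two categories in the top row are empty, so \<open>src C (n - 1)\<close> is never evaluated.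
\<close>

definition is_basis :: "'a ocat \<Rightarrow> nat \<Rightarrow> 'a set \<Rightarrow> bool" where
  "is_basis C n E \<longleftrightarrow> E \<subseteq> cells C n \<and>
     cocartesian
       (copies E (skel n (globe n))) (skel n C)
       (copies E (globe n)) (skel (Suc n) C)
       (\<lambda>k (x, c). pair_map C (n - 1) (src C (n - 1) x) (tgt C (n - 1) x) k c)
       (\<lambda>k xc. xc)
       (\<lambda>k y. y)
       (\<lambda>k (x, c). cell_map C n x k c)"

definition free_omega_category :: "'a ocat \<Rightarrow> bool" where
  "free_omega_category C \<longleftrightarrow> omega_category C \<and> (\<forall>n. \<exists>E. is_basis C n E)"


section \<open>Discrete Conduche functors\<close>

definition discrete_conduche :: "'a ocat \<Rightarrow> 'b ocat \<Rightarrow> (nat \<Rightarrow> 'a \<Rightarrow> 'b) \<Rightarrow> bool" where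
  "discrete_conduche C D F \<longleftrightarrow> omega_functor C D F \<and>
     (\<forall>n k. k < n \<longrightarrow>
        (\<forall>x\<in>cells C n. \<forall>y\<in>cells D k. F n x = unit_to D k n y \<longrightarrow>
           (\<exists>!z. z \<in> cells C k \<and> x = unit_to C k n z \<and> F k z = y)) \<and>
        (\<forall>x\<in>cells C n. \<forall>y' y''. composable D n k y' y'' \<and> F n x = composite D n k y' y'' \<longrightarrow>
           (\<exists>!(x', x''). composable C n k x' x'' \<and> x = composite C n k x' x'' \<and>
              F n x' = y' \<and> F n x'' = y'')))"


section \<open>The universal property does not depend on the type of test objects\<close>

lemma src_to_cells_update [simp]: "src_to (C\<lparr>cells := S\<rparr>) n k x = src_to C n k x"
  by (induction n arbitrary: x) auto

lemma tgt_to_cells_update [simp]: "tgt_to (C\<lparr>cells := S\<rparr>) n k x = tgt_to C n k x"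
  by (induction n arbitrary: x) auto

lemma unit_to_cells_update [simp]: "unit_to (C\<lparr>cells := S\<rparr>) k n x = unit_to C k n x"
  by (induction n) auto

context omega_category
begin

lemma src_to_cell: "x \<in> cells C n \<Longrightarrow> k \<le> n \<Longrightarrow> src_to C n k x \<in> cells C k"
  by (induction n arbitrary: x) (auto simp: le_Suc_eq src_cell)

lemma tgt_to_cell: "x \<in> cells C n \<Longrightarrow> k \<le> n \<Longrightarrow> tgt_to C n k x \<in> cells C k"
  by (induction n arbitrary: x) (auto simp: le_Suc_eq tgt_cell)

lemma unit_to_cell: "x \<in> cells C k \<Longrightarrow> k \<le> n \<Longrightarrow> unit_to C k n x \<in> cells C n"
  by (induction n) (auto simp: le_Suc_eq unit_cell)

lemma subcategory:
  assumes S: "\<And>n. S n \<subseteq> cells C n"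
    and "\<And>n x. x \<in> S (Suc n) \<Longrightarrow> src C n x \<in> S n"
    and "\<And>n x. x \<in> S (Suc n) \<Longrightarrow> tgt C n x \<in> S n"
    and "\<And>n x. x \<in> S n \<Longrightarrow> unit C n x \<in> S (Suc n)"
    and "\<And>n k x y. composable C n k x y \<Longrightarrow> x \<in> S n \<Longrightarrow> y \<in> S n \<Longrightarrow> composite C n k x y \<in> S n"
  shows "omega_category (C\<lparr>cells := S\<rparr>)"
proof -
  have c: "composable (C\<lparr>cells := S\<rparr>) n k x y \<longleftrightarrow> composable C n k x y \<and> x \<in> S n \<and> y \<in> S n"
    for n k x y using S by (auto simp: composable_def)
  have S': "\<And>n x. x \<in> S n \<Longrightarrow> x \<in> cells C n" using S by blast
  have u: "cells (C\<lparr>cells := S\<rparr>) = S" "src (C\<lparr>cells := S\<rparr>) = src C" "tgt (C\<lparr>cells := S\<rparr>) = tgt C"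
    "unit (C\<lparr>cells := S\<rparr>) = unit C" "composite (C\<lparr>cells := S\<rparr>) = composite C" by simp_all
  show ?thesis
  proof (rule omega_category.intro, unfold u c src_to_cells_update tgt_to_cells_update
      unit_to_cells_update, goal_cases)
    case 1 then show ?case using assms(2) by blast
  next
    case 2 then show ?case using assms(3) by blast
  next
    case 3 then show ?case using src_src S' by blast
  next
    case 4 then show ?case using tgt_tgt S' by blast
  next
    case 5 then show ?case using assms(4) by blast
  next
    case 6 then show ?case using src_unit S' by blast
  next
    case 7 then show ?case using tgt_unit S' by blast
  next
    case 8 then show ?case using assms(5) by blast
  next
    case 9 then show ?case using src_comp_top by blast
  next
    case 10 then show ?case using tgt_comp_top by blast
  next
    case 11 then show ?case using src_comp by blast
  next
    case 12 then show ?case using tgt_comp by blast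
  next
    case 13 then show ?case using unit_left S' by blast
  next
    case 14 then show ?case using unit_right S' by blast
  next
    case 15 then show ?case using unit_comp by blast
  next
    case 16 then show ?case using assoc by blast
  next
    case 17 then show ?case using exchange by blast
  qed
qed

end

text \<open>Transport of the structure of \<open>C\<close> along maps \<open>\<phi> n\<close> injective on the cells of \<open>C\<close>.\<close>

definition transport :: "('a \<Rightarrow> 'b) \<Rightarrow> ('b \<Rightarrow> 'a) \<Rightarrow> 'a ocat \<Rightarrow> 'b ocat" where
  "transport \<phi> \<psi> C =
     \<lparr>cells = (\<lambda>n. \<phi> ` cells C n),
      src = (\<lambda>n x. \<phi> (src C n (\<psi> x))),
      tgt = (\<lambda>n x. \<phi> (tgt C n (\<psi> x))),
      unit = (\<lambda>n x. \<phi> (unit C n (\<psi> x))),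
      composite = (\<lambda>n k x y. \<phi> (composite C n k (\<psi> x) (\<psi> y)))\<rparr>"

context omega_category
begin

context
  fixes \<phi> :: "'a \<Rightarrow> 'b" and \<psi>
  assumes inv: "\<And>n x. x \<in> cells C n \<Longrightarrow> \<psi> (\<phi> x) = x"
begin

lemma transport_cells: "cells (transport \<phi> \<psi> C) n = \<phi> ` cells C n"
  by (simp add: transport_def)

lemma transport_src_to:
  "x \<in> cells C n \<Longrightarrow> k \<le> n \<Longrightarrow> src_to (transport \<phi> \<psi> C) n k (\<phi> x) = \<phi> (src_to C n k x)"
  by (induction n arbitrary: x) (auto simp: le_Suc_eq src_cell transport_def inv)

lemma transport_tgt_to:
  "x \<in> cells C n \<Longrightarrow> k \<le> n \<Longrightarrow> tgt_to (transport \<phi> \<psi> C) n k (\<phi> x) = \<phi> (tgt_to C n k x)"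
  by (induction n arbitrary: x) (auto simp: le_Suc_eq tgt_cell transport_def inv)

lemma transport_unit_to:
  "x \<in> cells C k \<Longrightarrow> k \<le> n \<Longrightarrow> unit_to (transport \<phi> \<psi> C) k n (\<phi> x) = \<phi> (unit_to C k n x)"
proof (induction n)
  case (Suc n)
  then show ?case
    using inv[OF unit_to_cell[of x k n]] by (auto simp: le_Suc_eq transport_def)
qed auto

lemma transport_composable:
  assumes "composable (transport \<phi> \<psi> C) n k x' y'"
  obtains x y where "x' = \<phi> x" "y' = \<phi> y" "composable C n k x y"
proof -
  obtain x y where xy: "x' = \<phi> x" "y' = \<phi> y" "x \<in> cells C n" "y \<in> cells C n" "k < n"
    using assms by (auto simp: composable_def transport_def)
  then have "\<phi> (src_to C n k x) = \<phi> (tgt_to C n k y)"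
    using assms by (simp add: composable_def transport_src_to transport_tgt_to)
  then have "src_to C n k x = tgt_to C n k y"
    using inv src_to_cell[of x n k] tgt_to_cell[of y n k] xy by (metis less_imp_le)
  then show thesis using xy that by (simp add: composable_def)
qed

lemma transport_composable_iff:
  "x \<in> cells C n \<Longrightarrow> y \<in> cells C n \<Longrightarrow>
    composable (transport \<phi> \<psi> C) n k (\<phi> x) (\<phi> y) \<longleftrightarrow> composable C n k x y"
  unfolding composable_def transport_cells
  using transport_src_to[of x n k] transport_tgt_to[of y n k]
    inv[OF src_to_cell[of x n k]] inv[OF tgt_to_cell[of y n k]]
  by (metis imageI less_imp_le)

lemma transport_simps:
  "x \<in> cells C (Suc n) \<Longrightarrow> src (transport \<phi> \<psi> C) n (\<phi> x) = \<phi> (src C n x)"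
  "x \<in> cells C (Suc n) \<Longrightarrow> tgt (transport \<phi> \<psi> C) n (\<phi> x) = \<phi> (tgt C n x)"
  "x \<in> cells C n \<Longrightarrow> unit (transport \<phi> \<psi> C) n (\<phi> x) = \<phi> (unit C n x)"
  "x \<in> cells C n \<Longrightarrow> y \<in> cells C n \<Longrightarrow>
     composite (transport \<phi> \<psi> C) n k (\<phi> x) (\<phi> y) = \<phi> (composite C n k x y)"
  by (auto simp: transport_def inv)

lemma transport_omega_category: "omega_category (transport \<phi> \<psi> C)"
proof -
  have comp1: "\<And>n k x y. composable C n k x y \<Longrightarrow> x \<in> cells C n"
    and comp2: "\<And>n k x y. composable C n k x y \<Longrightarrow> y \<in> cells C n"
    and comp3: "\<And>n k x y. composable C n k x y \<Longrightarrow> k < n"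
    by (auto simp: composable_def)
  note s = transport_simps transport_src_to transport_tgt_to transport_unit_to
    src_cell tgt_cell unit_cell src_src tgt_tgt src_unit tgt_unit unit_left unit_right
    src_to_cell tgt_to_cell unit_to_cell
  show ?thesis
  proof (rule omega_category.intro, goal_cases)
    case (8 n k x y)
    then obtain x1 y1 where c: "x = \<phi> x1" "y = \<phi> y1" "composable C n k x1 y1"
      by (elim transport_composable)
    show ?case using c(1,2) comp1[OF c(3)] comp2[OF c(3)] comp_cell[OF c(3)] comp_cell[OF c(3)]
      by (simp add: transport_simps transport_cells)
  next
    case (9 n x y)
    then obtain x1 y1 where c: "x = \<phi> x1" "y = \<phi> y1" "composable C (Suc n) n x1 y1"
      by (elim transport_composable)
    show ?case using c(1,2) comp1[OF c(3)] comp2[OF c(3)] comp_cell[OF c(3)] src_comp_top[OF c(3)]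
      by (simp add: transport_simps transport_cells)
  next
    case (10 n x y)
    then obtain x1 y1 where c: "x = \<phi> x1" "y = \<phi> y1" "composable C (Suc n) n x1 y1"
      by (elim transport_composable)
    show ?case using c(1,2) comp1[OF c(3)] comp2[OF c(3)] comp_cell[OF c(3)] tgt_comp_top[OF c(3)]
      by (simp add: transport_simps transport_cells)
  next
    case (11 n k x y)
    then obtain x1 y1 where c: "x = \<phi> x1" "y = \<phi> y1" "composable C (Suc n) k x1 y1"
      by (elim transport_composable)
    show ?case using c(1,2) 11(2) comp1[OF c(3)] comp2[OF c(3)] comp_cell[OF c(3)] src_comp[OF c(3)]
      by (simp add: s)
  next
    case (12 n k x y)
    then obtain x1 y1 where c: "x = \<phi> x1" "y = \<phi> y1" "composable C (Suc n) k x1 y1"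
      by (elim transport_composable)
    show ?case using c(1,2) 12(2) comp1[OF c(3)] comp2[OF c(3)] comp_cell[OF c(3)] tgt_comp[OF c(3)]
      by (simp add: s)
  next
    case (15 n k x y)
    then obtain x1 y1 where c: "x = \<phi> x1" "y = \<phi> y1" "composable C n k x1 y1"
      by (elim transport_composable)
    show ?case using c(1,2) comp1[OF c(3)] comp2[OF c(3)] comp_cell[OF c(3)] unit_comp[OF c(3)]
      by (simp add: s)
  next
    case (16 n k x y z)
    then obtain x1 y1 where c: "x = \<phi> x1" "y = \<phi> y1" "composable C n k x1 y1"
      by (elim transport_composable)
    obtain z1 where z: "z = \<phi> z1" "z1 \<in> cells C n"
      using 16(2) by (auto simp: composable_def transport_cells)
    have d: "composable C n k y1 z1"
      using 16(2) c z comp2 by (simp add: transport_composable_iff)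
    have e: "composite C n k x1 y1 \<in> cells C n" "composite C n k y1 z1 \<in> cells C n"
      using c d comp_cell by auto
    show ?case using c(1,2) z e comp1[OF c(3)] comp2[OF c(3)] assoc[OF c(3) d]
      by (simp add: transport_simps)
  next
    case (17 l k n x x' y y')
    then obtain x1 x1' where c: "x = \<phi> x1" "x' = \<phi> x1'" "composable C n k x1 x1'"
      by (elim transport_composable)
    obtain y1 y1' where d: "y = \<phi> y1" "y' = \<phi> y1'" "composable C n k y1 y1'"
      using 17(3) by (elim transport_composable)
    have ce: "x1 \<in> cells C n" "x1' \<in> cells C n" "y1 \<in> cells C n" "y1' \<in> cells C n"
      using c d comp1 comp2 by auto
    have e: "composable C n l x1 y1" "composable C n l x1' y1'"
      using 17(4,5) c d ce by (simp_all add: transport_composable_iff)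
    have cc: "composite C n k x1 x1' \<in> cells C n" "composite C n k y1 y1' \<in> cells C n"
      "composite C n l x1 y1 \<in> cells C n" "composite C n l x1' y1' \<in> cells C n"
      using c d e comp_cell by auto
    show ?case using c(1,2) d(1,2) ce cc exchange[OF 17(1) c(3) d(3) e]
      by (simp add: transport_simps)
  qed (simp only: transport_cells, erule imageE, simp add: s)+
qed

lemma transport_functor: "omega_functor C (transport \<phi> \<psi> C) (\<lambda>n. \<phi>)"
proof -
  interpret U: omega_category "transport \<phi> \<psi> C" by (rule transport_omega_category)
  show ?thesis
    by unfold_locales
      (auto simp: transport_cells transport_simps composable_def)
qed

lemma transport_functor_inv: "omega_functor (transport \<phi> \<psi> C) C (\<lambda>n. \<psi>)"
proof -
  interpret U: omega_category "transport \<phi> \<psi> C" by (rule transport_omega_category)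
  show ?thesis
  proof (unfold_locales, goal_cases)
    case (5 n k x y)
    then obtain x1 y1 where c: "x = \<phi> x1" "y = \<phi> y1" "composable C n k x1 y1"
      by (elim transport_composable)
    then have "x1 \<in> cells C n" "y1 \<in> cells C n" "composite C n k x1 y1 \<in> cells C n"
      using comp_cell by (auto simp: composable_def)
    then show ?case using c(1,2) by (simp add: transport_simps inv)
  qed (auto simp: transport_cells transport_simps inv inv[OF src_cell] inv[OF tgt_cell] inv[OF unit_cell])
qed

end

end

text \<open>
  Every family of generators \<open>\<gamma>\<close> in \<open>T\<close> lies in a subcategory all of whose cells are named by
  formal expressions.
\<close>

datatype 'g expr =
    Gen nat 'g
  | Src nat "'g expr"
  | Tgt nat "'g expr"
  | Unit nat "'g expr"
  | Comp nat nat "'g expr" "'g expr"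

primrec expr_val :: "'t ocat \<Rightarrow> (nat \<Rightarrow> 'g \<Rightarrow> 't) \<Rightarrow> 'g expr \<Rightarrow> 't" where
  "expr_val T \<gamma> (Gen n g) = \<gamma> n g"
| "expr_val T \<gamma> (Src n e) = src T n (expr_val T \<gamma> e)"
| "expr_val T \<gamma> (Tgt n e) = tgt T n (expr_val T \<gamma> e)"
| "expr_val T \<gamma> (Unit n e) = unit T n (expr_val T \<gamma> e)"
| "expr_val T \<gamma> (Comp n k e e') = composite T n k (expr_val T \<gamma> e) (expr_val T \<gamma> e')"

primrec expr_code :: "'g expr \<Rightarrow> (nat + 'g) list" where
  "expr_code (Gen n g) = [Inl 0, Inl n, Inr g]"
| "expr_code (Src n e) = [Inl 1, Inl n] @ expr_code e"
| "expr_code (Tgt n e) = [Inl 2, Inl n] @ expr_code e"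
| "expr_code (Unit n e) = [Inl 3, Inl n] @ expr_code e"
| "expr_code (Comp n k e e') = [Inl 4, Inl n, Inl k] @ expr_code e @ expr_code e'"

lemma expr_code_append:
  "expr_code e @ xs = expr_code e' @ ys \<Longrightarrow> e = e' \<and> xs = ys"
proof (induction e arbitrary: e' xs ys)
  case (Gen n g)
  then show ?case by (cases e') auto
next
  case (Src n e)
  then show ?case by (cases e') auto
next
  case (Tgt n e)
  then show ?case by (cases e') auto
next
  case (Unit n e)
  then show ?case by (cases e') auto
next
  case (Comp n k e1 e2)
  show ?case
  proof (cases e')
    case (Comp n' k' e1' e2')
    with Comp.prems have eq: "n = n'" "k = k'"
      "expr_code e1 @ (expr_code e2 @ xs) = expr_code e1' @ (expr_code e2' @ ys)" by auto
    with Comp.IH Comp show ?thesis by blast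
  qed (use Comp.prems in auto)
qed

lemma inj_expr_code: "inj expr_code"
  by (rule injI) (metis append_Nil2 expr_code_append)

lemma small_subcategory:
  fixes T :: "'t ocat" and \<gamma> :: "nat \<Rightarrow> 'g \<Rightarrow> 't"
  assumes "omega_category T"
  shows "\<exists>(U :: (nat + 'g) list ocat) \<phi> \<psi> S. U = transport \<phi> \<psi> (T\<lparr>cells := S\<rparr>) \<and>
    omega_category (T\<lparr>cells := S\<rparr>) \<and> omega_category U \<and> (\<forall>n. S n \<subseteq> cells T n) \<and>
    (\<forall>n m g. \<gamma> m g \<in> cells T n \<longrightarrow> \<gamma> m g \<in> S n) \<and> (\<forall>n. \<forall>x\<in>S n. \<psi> (\<phi> x) = x)"
proof -
  interpret T: omega_category T by fact
  define S where "S n = cells T n \<inter> range (expr_val T \<gamma>)" for n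
  define \<phi> where "\<phi> = expr_code \<circ> inv (expr_val T \<gamma>)"
  define \<psi> where "\<psi> = expr_val T \<gamma> \<circ> inv expr_code"
  have inv: "\<psi> (\<phi> x) = x" if "x \<in> S n" for n x
    using that by (auto simp: \<phi>_def \<psi>_def S_def inj_expr_code f_inv_into_f)
  have r: "src T n z \<in> range (expr_val T \<gamma>)" "tgt T n z \<in> range (expr_val T \<gamma>)"
    "unit T n z \<in> range (expr_val T \<gamma>)" if z: "z \<in> range (expr_val T \<gamma>)" for n z
  proof -
    obtain e where e: "z = expr_val T \<gamma> e" using z by blast
    show "src T n z \<in> range (expr_val T \<gamma>)" "tgt T n z \<in> range (expr_val T \<gamma>)"
      "unit T n z \<in> range (expr_val T \<gamma>)"
      using rangeI[of "expr_val T \<gamma>" "Src n e"] rangeI[of "expr_val T \<gamma>" "Tgt n e"]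
        rangeI[of "expr_val T \<gamma>" "Unit n e"] by (simp_all only: e expr_val.simps)
  qed
  have r': "composite T n k z z' \<in> range (expr_val T \<gamma>)"
    if z: "z \<in> range (expr_val T \<gamma>)" "z' \<in> range (expr_val T \<gamma>)" for n k z z'
  proof -
    obtain e e' where e: "z = expr_val T \<gamma> e" "z' = expr_val T \<gamma> e'" using z by blast
    show ?thesis
      using rangeI[of "expr_val T \<gamma>" "Comp n k e e'"] by (simp only: e expr_val.simps)
  qed
  have sub: "omega_category (T\<lparr>cells := S\<rparr>)"
  proof (rule T.subcategory, unfold S_def, goal_cases)
    case (2 n x)
    then show ?case using T.src_cell r(1)[of x n] by simp
  next
    case (3 n x)
    then show ?case using T.tgt_cell r(2)[of x n] by simp
  next
    case (4 n x)
    then show ?case using T.unit_cell r(3)[of x n] by simp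
  next
    case (5 n k x y)
    then show ?case using T.comp_cell r'[of x y n k] by simp
  qed simp
  have U: "omega_category (transport \<phi> \<psi> (T\<lparr>cells := S\<rparr>))"
    by (rule omega_category.transport_omega_category[OF sub]) (simp add: inv)
  have G: "\<gamma> m g \<in> S n" if "\<gamma> m g \<in> cells T n" for n m g
    using that rangeI[of "expr_val T \<gamma>" "Gen m g"]
    by (simp only: S_def expr_val.simps IntI)
  have S: "S n \<subseteq> cells T n" for n
    by (simp add: S_def)
  show ?thesis
    using sub U S G inv by (intro exI[of _ "transport \<phi> \<psi> (T\<lparr>cells := S\<rparr>)"] exI[of _ \<phi>]
        exI[of _ \<psi>] exI[of _ S] conjI refl) blast+
qed

context omega_functor
begin

lemma map_src_to: "x \<in> cells A n \<Longrightarrow> k \<le> n \<Longrightarrow> F k (src_to A n k x) = src_to B n k (F n x)"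
  by (induction n arbitrary: x) (auto simp: le_Suc_eq map_src dom.src_cell)

lemma map_tgt_to: "x \<in> cells A n \<Longrightarrow> k \<le> n \<Longrightarrow> F k (tgt_to A n k x) = tgt_to B n k (F n x)"
  by (induction n arbitrary: x) (auto simp: le_Suc_eq map_tgt dom.tgt_cell)

lemma map_unit_to: "x \<in> cells A k \<Longrightarrow> k \<le> n \<Longrightarrow> F n (unit_to A k n x) = unit_to B k n (F k x)"
  by (induction n) (auto simp: le_Suc_eq map_unit dom.unit_to_cell)

lemma map_composable: "composable A n k x y \<Longrightarrow> composable B n k (F n x) (F n y)"
  by (auto simp: composable_def map_cell map_src_to[symmetric] map_tgt_to[symmetric])

end

lemma omega_functor_comp:
  assumes "omega_functor A B F" "omega_functor B C G"
  shows "omega_functor A C (\<lambda>n x. G n (F n x))"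
proof -
  interpret F: omega_functor A B F by fact
  interpret G: omega_functor B C G by fact
  show ?thesis
    by unfold_locales
      (simp_all add: F.map_cell G.map_cell F.map_src G.map_src F.map_tgt G.map_tgt
        F.map_unit G.map_unit F.map_comp G.map_comp F.map_composable)
qed

lemma omega_functor_restrict_cod:
  assumes F: "omega_functor A T F" and "omega_category (T\<lparr>cells := S\<rparr>)"
    and "\<And>n x. x \<in> cells A n \<Longrightarrow> F n x \<in> S n"
  shows "omega_functor A (T\<lparr>cells := S\<rparr>) F"
proof -
  interpret F: omega_functor A T F by fact
  interpret S: omega_category "T\<lparr>cells := S\<rparr>" by fact
  show ?thesis
    by unfold_locales
      (simp_all add: assms(3) F.map_src F.map_tgt F.map_unit F.map_comp)
qed

lemma omega_functor_inclusion:
  assumes "omega_category T" "omega_category (T\<lparr>cells := S\<rparr>)" "\<And>n. S n \<subseteq> cells T n"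
  shows "omega_functor (T\<lparr>cells := S\<rparr>) T (\<lambda>n x. x)"
proof -
  interpret T: omega_category T by fact
  interpret S: omega_category "T\<lparr>cells := S\<rparr>" by fact
  show ?thesis using assms(3) by unfold_locales auto
qed

theorem cocartesian_all_types:
  fixes A :: "'a ocat" and B :: "'b ocat" and B' :: "'c ocat" and P :: "'d ocat"
  assumes coc: "cocartesian A B B' P f g u v"
  shows "cocartesian_for TYPE('t) A B B' P f g u v"
proof -
  note c = coc[unfolded cocartesian_def cocartesian_for_def]
  note c_univ = c[THEN conjunct2, THEN conjunct2, THEN conjunct2, THEN conjunct2, THEN conjunct2,
      THEN spec, THEN spec, THEN spec, THEN mp, OF conjI, OF _ conjI]
  have ex: "\<exists>h. omega_functor P T h \<and> (\<forall>n. \<forall>y\<in>cells B n. h n (u n y) = p n y) \<and>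
      (\<forall>n. \<forall>z\<in>cells B' n. h n (v n z) = q n z)"
    if p: "omega_functor B T p" and q: "omega_functor B' T q"
      and pq: "\<forall>n. \<forall>x\<in>cells A n. p n (f n x) = q n (g n x)" for T :: "'t ocat" and p q
  proof -
    interpret p: omega_functor B T p by fact
    interpret q: omega_functor B' T q by fact
    define \<gamma> :: "nat \<Rightarrow> ('b + 'c + 'd) \<Rightarrow> 't" where "\<gamma> n = case_sum (p n) (case_sum (q n) undefined)" for n
    obtain U :: "(nat + ('b + 'c + 'd)) list ocat" and \<phi> \<psi> S where U:
      "U = transport \<phi> \<psi> (T\<lparr>cells := S\<rparr>)" "omega_category (T\<lparr>cells := S\<rparr>)" "omega_category U"
      "\<And>n. S n \<subseteq> cells T n" "\<And>n m g. \<gamma> m g \<in> cells T n \<Longrightarrow> \<gamma> m g \<in> S n"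
      "\<And>n x. x \<in> S n \<Longrightarrow> \<psi> (\<phi> x) = x"
      using small_subcategory[OF p.cod.omega_category_axioms, where \<gamma> = \<gamma>] by blast
    have pS: "p n x \<in> S n" if "x \<in> cells B n" for n x
      using U(5)[of n "Inl x" n] p.map_cell[OF that] by (simp add: \<gamma>_def)
    have qS: "q n x \<in> S n" if "x \<in> cells B' n" for n x
      using U(5)[of n "Inr (Inl x)" n] q.map_cell[OF that] by (simp add: \<gamma>_def)
    have \<phi>: "omega_functor (T\<lparr>cells := S\<rparr>) U (\<lambda>n. \<phi>)"
      unfolding U(1) by (rule omega_category.transport_functor[OF U(2)]) (simp add: U(6))
    have \<psi>: "omega_functor U (T\<lparr>cells := S\<rparr>) (\<lambda>n. \<psi>)"
      unfolding U(1) by (rule omega_category.transport_functor_inv[OF U(2)]) (simp add: U(6))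
    have j: "omega_functor U T (\<lambda>n. \<psi>)"
      using omega_functor_comp[OF \<psi>
          omega_functor_inclusion[OF p.cod.omega_category_axioms U(2,4)]] .
    have F: "omega_functor B U (\<lambda>n x. \<phi> (p n x))" "omega_functor B' U (\<lambda>n x. \<phi> (q n x))"
      by (rule omega_functor_comp[OF omega_functor_restrict_cod[OF _ U(2)] \<phi>]; fact p q pS qS)+
    obtain h where h: "omega_functor P U h"
      "\<forall>n. \<forall>y\<in>cells B n. h n (u n y) = \<phi> (p n y)"
      "\<forall>n. \<forall>z\<in>cells B' n. h n (v n z) = \<phi> (q n z)"
      using c_univ[OF F] pq by auto
    show ?thesis
      using omega_functor_comp[OF h(1) j] h(2,3) U(6)[OF pS] U(6)[OF qS]
      by (intro exI[of _ "\<lambda>n x. \<psi> (h n x)"]) auto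
  qed
  have unique: "h n w = h' n w"
    if h: "omega_functor P T h" and h': "omega_functor P T h'"
      and hu: "\<forall>n. \<forall>y\<in>cells B n. h n (u n y) = h' n (u n y)"
      and hv: "\<forall>n. \<forall>z\<in>cells B' n. h n (v n z) = h' n (v n z)"
      and w: "w \<in> cells P n" for T :: "'t ocat" and h h' n w
  proof -
    interpret h: omega_functor P T h by fact
    interpret h': omega_functor P T h' by fact
    interpret u: omega_functor B P u using c by blast
    interpret v: omega_functor B' P v using c by blast
    define \<gamma> :: "nat \<Rightarrow> ('b + 'c + 'd) \<Rightarrow> 't" where "\<gamma> m = case_sum undefined (case_sum undefined
      (if even m then h (m div 2) else h' (m div 2)))" for m
    obtain U :: "(nat + ('b + 'c + 'd)) list ocat" and \<phi> \<psi> S where U: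
      "U = transport \<phi> \<psi> (T\<lparr>cells := S\<rparr>)" "omega_category (T\<lparr>cells := S\<rparr>)" "omega_category U"
      "\<And>n. S n \<subseteq> cells T n" "\<And>n m g. \<gamma> m g \<in> cells T n \<Longrightarrow> \<gamma> m g \<in> S n"
      "\<And>n x. x \<in> S n \<Longrightarrow> \<psi> (\<phi> x) = x"
      using small_subcategory[OF h.cod.omega_category_axioms, where \<gamma> = \<gamma>] by blast
    have hS: "h n x \<in> S n" if "x \<in> cells P n" for n x
      using U(5)[of "2 * n" "Inr (Inr x)" n] h.map_cell[OF that] by (simp add: \<gamma>_def)
    have hS': "h' n x \<in> S n" if "x \<in> cells P n" for n x
      using U(5)[of "Suc (2 * n)" "Inr (Inr x)" n] h'.map_cell[OF that] by (simp add: \<gamma>_def)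
    have \<phi>: "omega_functor (T\<lparr>cells := S\<rparr>) U (\<lambda>n. \<phi>)"
      unfolding U(1) by (rule omega_category.transport_functor[OF U(2)]) (simp add: U(6))
    define k k' where "k = (\<lambda>n x. \<phi> (h n x))" and "k' = (\<lambda>n x. \<phi> (h' n x))"
    have k: "omega_functor P U k" "omega_functor P U k'"
      unfolding k_def k'_def
      by (rule omega_functor_comp[OF omega_functor_restrict_cod[OF _ U(2)] \<phi>]; fact h h' hS hS')+
    have p: "omega_functor B U (\<lambda>n x. k n (u n x))" "omega_functor B' U (\<lambda>n x. k n (v n x))"
      using omega_functor_comp k(1) u.omega_functor_axioms v.omega_functor_axioms by blast+
    have comm: "\<forall>n. \<forall>x\<in>cells A n. k n (u n (f n x)) = k n (v n (g n x))"
      using c by simp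
    obtain l where l: "\<And>k'. omega_functor P U k' \<Longrightarrow>
        \<forall>n. \<forall>y\<in>cells B n. k' n (u n y) = k n (u n y) \<Longrightarrow>
        \<forall>n. \<forall>z\<in>cells B' n. k' n (v n z) = k n (v n z) \<Longrightarrow>
        \<forall>n. \<forall>w\<in>cells P n. k' n w = l n w"
      using c_univ[OF p comm] by blast
    have "k n w = k' n w"
      using l[OF k(1)] l[OF k(2)] hu hv w by (simp add: k_def k'_def)
    then show ?thesis using U(6) hS[OF w] hS'[OF w] by (metis k_def k'_def)
  qed
  have univ: "\<exists>h. omega_functor P T h \<and> (\<forall>n. \<forall>y\<in>cells B n. h n (u n y) = p n y) \<and>
      (\<forall>n. \<forall>z\<in>cells B' n. h n (v n z) = q n z) \<and>
      (\<forall>h'. omega_functor P T h' \<and> (\<forall>n. \<forall>y\<in>cells B n. h' n (u n y) = p n y) \<and>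
        (\<forall>n. \<forall>z\<in>cells B' n. h' n (v n z) = q n z) \<longrightarrow> (\<forall>n. \<forall>w\<in>cells P n. h' n w = h n w))"
    if pq: "omega_functor B T p \<and> omega_functor B' T q \<and>
      (\<forall>n. \<forall>x\<in>cells A n. p n (f n x) = q n (g n x))" for T :: "'t ocat" and p q
  proof -
    obtain h where h: "omega_functor P T h" "\<forall>n. \<forall>y\<in>cells B n. h n (u n y) = p n y"
      "\<forall>n. \<forall>z\<in>cells B' n. h n (v n z) = q n z"
      using ex[of T p q] pq by blast
    have "\<forall>n. \<forall>w\<in>cells P n. h' n w = h n w"
      if "omega_functor P T h' \<and> (\<forall>n. \<forall>y\<in>cells B n. h' n (u n y) = p n y) \<and>
        (\<forall>n. \<forall>z\<in>cells B' n. h' n (v n z) = q n z)" for h'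
      using unique[of T h' h] h that by simp
    then show ?thesis using h by blast
  qed
  show ?thesis
    unfolding cocartesian_for_def
  proof (intro conjI)
    show "\<forall>(T :: 't ocat) p q. omega_functor B T p \<and> omega_functor B' T q \<and>
        (\<forall>n. \<forall>x\<in>cells A n. p n (f n x) = q n (g n x)) \<longrightarrow>
        (\<exists>h. omega_functor P T h \<and> (\<forall>n. \<forall>y\<in>cells B n. h n (u n y) = p n y) \<and>
          (\<forall>n. \<forall>z\<in>cells B' n. h n (v n z) = q n z) \<and>
          (\<forall>h'. omega_functor P T h' \<and> (\<forall>n. \<forall>y\<in>cells B n. h' n (u n y) = p n y) \<and>
            (\<forall>n. \<forall>z\<in>cells B' n. h' n (v n z) = q n z) \<longrightarrow>
            (\<forall>n. \<forall>w\<in>cells P n. h' n w = h n w)))"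
      by (intro allI impI univ)
  qed (insert c, (elim conjE, assumption)+)
qed

section \<open>The square in the definition of bases\<close>

context omega_category
begin

lemma src_to_same [simp]: "src_to C n n x = x"
  by (cases n) auto

lemma tgt_to_same [simp]: "tgt_to C n n x = x"
  by (cases n) auto

lemma unit_to_same [simp]: "unit_to C n n x = x"
  by (cases n) auto

lemma src_to_unit_to:
  "x \<in> cells C j \<Longrightarrow> j \<le> n \<Longrightarrow> k \<le> n \<Longrightarrow>
    src_to C n k (unit_to C j n x) = (if j \<le> k then unit_to C j k x else src_to C j k x)"
  by (induction n) (auto simp: le_Suc_eq src_unit unit_to_cell)

lemma tgt_to_unit_to:
  "x \<in> cells C j \<Longrightarrow> j \<le> n \<Longrightarrow> k \<le> n \<Longrightarrow>
    tgt_to C n k (unit_to C j n x) = (if j \<le> k then unit_to C j k x else tgt_to C j k x)"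
  by (induction n) (auto simp: le_Suc_eq tgt_unit unit_to_cell)

lemma unit_to_unit_to: "j \<le> k \<Longrightarrow> k \<le> n \<Longrightarrow> unit_to C k n (unit_to C j k x) = unit_to C j n x"
  by (induction n) (auto simp: le_Suc_eq)

lemma src_src_to: "x \<in> cells C n \<Longrightarrow> k < n \<Longrightarrow> src C k (src_to C n (Suc k) x) = src_to C n k x"
proof (induction n arbitrary: x)
  case (Suc n)
  then show ?case by (cases "k = n") (auto simp: src_cell)
qed simp

lemma tgt_tgt_to: "x \<in> cells C n \<Longrightarrow> k < n \<Longrightarrow> tgt C k (tgt_to C n (Suc k) x) = tgt_to C n k x"
proof (induction n arbitrary: x)
  case (Suc n)
  then show ?case by (cases "k = n") (auto simp: tgt_cell)
qed simp

lemma src_to_src_to: "j \<le> k \<Longrightarrow> k \<le> n \<Longrightarrow> src_to C k j (src_to C n k x) = src_to C n j x"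
  by (induction n arbitrary: x) (auto simp: le_Suc_eq)

lemma tgt_to_tgt_to: "j \<le> k \<Longrightarrow> k \<le> n \<Longrightarrow> tgt_to C k j (tgt_to C n k x) = tgt_to C n j x"
  by (induction n arbitrary: x) (auto simp: le_Suc_eq)

lemma src_to_tgt: "x \<in> cells C (Suc n) \<Longrightarrow> k < n \<Longrightarrow> src_to C n k (tgt C n x) = src_to C n k (src C n x)"
  by (cases n) (auto simp: src_src)

lemma tgt_to_src: "x \<in> cells C (Suc n) \<Longrightarrow> k < n \<Longrightarrow> tgt_to C n k (src C n x) = tgt_to C n k (tgt C n x)"
  by (cases n) (auto simp: tgt_tgt)

lemma src_tgt_to: "x \<in> cells C n \<Longrightarrow> Suc k < n \<Longrightarrow> src C k (tgt_to C n (Suc k) x) = src_to C n k x"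
proof (induction n arbitrary: x)
  case (Suc n)
  show ?case
  proof (cases "Suc k < n")
    case True
    then show ?thesis using Suc by (simp add: tgt_cell src_to_tgt)
  next
    case False
    then have "n = Suc k" using Suc by simp
    then show ?thesis using Suc by (simp add: src_src)
  qed
qed simp

lemma tgt_src_to: "x \<in> cells C n \<Longrightarrow> Suc k < n \<Longrightarrow> tgt C k (src_to C n (Suc k) x) = tgt_to C n k x"
proof (induction n arbitrary: x)
  case (Suc n)
  show ?case
  proof (cases "Suc k < n")
    case True
    then show ?thesis using Suc by (simp add: src_cell tgt_to_src)
  next
    case False
    then have "n = Suc k" using Suc by simp
    then show ?thesis using Suc by (simp add: tgt_tgt)
  qed
qed simp

lemma src_to_tgt_to:
  assumes "x \<in> cells C n" "j < k" "k \<le> n"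
  shows "src_to C k j (tgt_to C n k x) = src_to C n j x"
proof (cases "k = n")
  case False
  then obtain k' where k: "k = Suc k'" "Suc k' < n" "j \<le> k'" using assms by (cases k) auto
  then show ?thesis using src_tgt_to[OF assms(1), of k'] by (simp add: src_to_src_to)
qed simp

lemma tgt_to_src_to:
  assumes "x \<in> cells C n" "j < k" "k \<le> n"
  shows "tgt_to C k j (src_to C n k x) = tgt_to C n j x"
proof (cases "k = n")
  case False
  then obtain k' where k: "k = Suc k'" "Suc k' < n" "j \<le> k'" using assms by (cases k) auto
  then show ?thesis using tgt_src_to[OF assms(1), of k'] by (simp add: tgt_to_tgt_to)
qed simp

lemma composable_unit_to:
  "composable C m k x y \<Longrightarrow> m \<le> n \<Longrightarrow> composable C n k (unit_to C m n x) (unit_to C m n y)"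
  by (auto simp: composable_def unit_to_cell src_to_unit_to tgt_to_unit_to)

lemma unit_to_comp:
  "composable C m k x y \<Longrightarrow> m \<le> n \<Longrightarrow>
    unit_to C m n (composite C m k x y) = composite C n k (unit_to C m n x) (unit_to C m n y)"
  by (induction n) (auto simp: le_Suc_eq unit_comp composable_unit_to)

lemma skel_omega_category: "omega_category (skel m C)"
  unfolding skel_def
proof (rule subcategory, goal_cases)
  case (1 n)
  then show ?case by (auto simp: unit_to_cell)
next
  case (2 n x)
  then obtain j y where x: "x = unit_to C j (Suc n) y" "j < m" "j \<le> Suc n" "y \<in> cells C j" by blast
  show ?case
  proof (cases "j = Suc n")
    case True
    then have "src C n x = unit_to C n n (src C n y)" "n < m" "src C n y \<in> cells C n"
      using x src_cell by auto
    then show ?thesis by blast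
  next
    case False
    then have "src C n x = unit_to C j n y" using x by (simp add: src_unit unit_to_cell)
    moreover have "j \<le> n" using x False by simp
    ultimately show ?thesis using x by blast
  qed
next
  case (3 n x)
  then obtain j y where x: "x = unit_to C j (Suc n) y" "j < m" "j \<le> Suc n" "y \<in> cells C j" by blast
  show ?case
  proof (cases "j = Suc n")
    case True
    then have "tgt C n x = unit_to C n n (tgt C n y)" "n < m" "tgt C n y \<in> cells C n"
      using x tgt_cell by auto
    then show ?thesis by blast
  next
    case False
    then have "tgt C n x = unit_to C j n y" using x by (simp add: tgt_unit unit_to_cell)
    moreover have "j \<le> n" using x False by simp
    ultimately show ?thesis using x by blast
  qed
next
  case (4 n x)
  then obtain j y where x: "x = unit_to C j n y" "j < m" "j \<le> n" "y \<in> cells C j" by blast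
  then have "unit C n x = unit_to C j (Suc n) y" by simp
  then show ?case using x by auto
next
  case (5 n k x y)
  show ?case
  proof (cases "n < m")
    case True
    then show ?thesis using comp_cell[OF 5(1)] unit_to_same[of n "composite C n k x y"]
      by (metis (mono_tags, lifting) mem_Collect_eq order_refl)
  next
    case False
    have top: "\<exists>z \<in> cells C (m - 1). w = unit_to C (m - 1) n z" "0 < m"
      if w: "w \<in> {unit_to C j n x |j x. j < m \<and> j \<le> n \<and> x \<in> cells C j}" for w
    proof -
      obtain j z where z: "w = unit_to C j n z" "j < m" "j \<le> n" "z \<in> cells C j" using w by blast
      then have "w = unit_to C (m - 1) n (unit_to C j (m - 1) z)"
        "unit_to C j (m - 1) z \<in> cells C (m - 1)"
        using False by (auto simp: unit_to_unit_to unit_to_cell)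
      then show "\<exists>z \<in> cells C (m - 1). w = unit_to C (m - 1) n z" "0 < m" using z by auto
    qed
    obtain x' where x': "x' \<in> cells C (m - 1)" "x = unit_to C (m - 1) n x'" using top 5 by blast
    obtain y' where y': "y' \<in> cells C (m - 1)" "y = unit_to C (m - 1) n y'" using top 5 by blast
    have m: "0 < m" using top 5 by blast
    have k: "k < n" "src_to C n k x = tgt_to C n k y" using 5 by (auto simp: composable_def)
    show ?thesis
    proof (cases "k < m - 1")
      case True
      then have c: "composable C (m - 1) k x' y'"
        using x' y' k False by (simp add: composable_def src_to_unit_to tgt_to_unit_to)
      then have "composite C n k x y = unit_to C (m - 1) n (composite C (m - 1) k x' y')"
        using x' y' False by (simp add: unit_to_comp)
      then show ?thesis using comp_cell[OF c] m False by fastforce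
    next
      case k': False
      then have "unit_to C (m - 1) k x' = unit_to C (m - 1) k y'"
        using x' y' k False by (simp add: src_to_unit_to tgt_to_unit_to)
      then have "x = unit_to C k n (tgt_to C n k y)"
        using x' y' k k' False unit_to_unit_to[of "m - 1" k n x']
          unit_to_unit_to[of "m - 1" k n y'] by (simp add: tgt_to_unit_to)
      then have "composite C n k x y = y"
        using 5(1) unit_left by (metis composable_def)
      then show ?thesis using 5(3) by simp
    qed
  qed
qed

lemma skel_cells: "n < m \<Longrightarrow> cells (skel m C) n = cells C n"
  by (auto simp: skel_def unit_to_cell) (metis order_refl unit_to_same)

lemma skel_mono: "m \<le> m' \<Longrightarrow> cells (skel m C) n \<subseteq> cells (skel m' C) n"
  unfolding skel_def by force

lemma skel_sub: "cells (skel m C) n \<subseteq> cells C n"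
  by (auto simp: skel_def unit_to_cell)

lemma skel_inclusion: "m \<le> m' \<Longrightarrow> omega_functor (skel m C) (skel m' C) (\<lambda>k y. y)"
  using omega_functor_inclusion[OF skel_omega_category[of m'], of "cells (skel m C)"]
    skel_omega_category[of m] skel_mono[of m m'] by (simp add: skel_def)

lemma copies_src_to: "src_to (copies E C) n k x = (fst x, src_to C n k (snd x))"
  by (induction n arbitrary: x) (auto simp: copies_def)

lemma copies_tgt_to: "tgt_to (copies E C) n k x = (fst x, tgt_to C n k (snd x))"
  by (induction n arbitrary: x) (auto simp: copies_def)

lemma copies_unit_to: "unit_to (copies E C) k n x = (fst x, unit_to C k n (snd x))"
  by (induction n) (auto simp: copies_def)

lemma copies_composable: "composable (copies E C) n k x y \<longleftrightarrow>
    fst x = fst y \<and> fst x \<in> E \<and> composable C n k (snd x) (snd y)"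
  unfolding composable_def copies_src_to copies_tgt_to by (auto simp: copies_def mem_Times_iff)

lemma copies_omega_category: "omega_category (copies E C)"
proof -
  have d: "cells (copies E C) n = E \<times> cells C n"
    "src (copies E C) n x = (fst x, src C n (snd x))"
    "tgt (copies E C) n x = (fst x, tgt C n (snd x))"
    "unit (copies E C) n x = (fst x, unit C n (snd x))"
    "composite (copies E C) n k x y = (fst x, composite C n k (snd x) (snd y))" for n k x y
    by (auto simp: copies_def split_beta)
  show ?thesis
  proof (rule omega_category.intro, unfold copies_composable d copies_src_to copies_tgt_to
      copies_unit_to, goal_cases)
    case (17 l k n x x' y y')
    then show ?case using exchange[of l k n "snd x" "snd x'" "snd y" "snd y'"] by simp
  next
    case (16 n k x y z)
    then show ?case using assoc by simp
  qed (auto simp: src_cell tgt_cell src_src tgt_tgt unit_cell src_unit tgt_unit comp_cell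
    src_comp_top tgt_comp_top src_comp tgt_comp unit_left unit_right unit_comp)
qed

end

lemma globe_src_to: "k \<le> m \<Longrightarrow> fst c \<le> m \<Longrightarrow>
    src_to (globe n) m k c = (if fst c \<le> k then c else (k, False))"
  by (induction m arbitrary: c) (auto simp: globe_def le_Suc_eq)

lemma globe_tgt_to: "k \<le> m \<Longrightarrow> fst c \<le> m \<Longrightarrow>
    tgt_to (globe n) m k c = (if fst c \<le> k then c else (k, True))"
  by (induction m arbitrary: c) (auto simp: globe_def le_Suc_eq)

lemma globe_unit_to: "unit_to (globe n) k m c = c"
  by (induction m) (auto simp: globe_def)

lemma globe_composable: "composable (globe n) m k c d \<longleftrightarrow>
    k < m \<and> c \<in> cells (globe n) m \<and> d \<in> cells (globe n) m \<and>
    (if fst c \<le> k then c = (if fst d \<le> k then d else (k, True)) else d = (k, False))"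
proof (cases "k < m \<and> c \<in> cells (globe n) m \<and> d \<in> cells (globe n) m")
  case True
  then have "fst c \<le> m" "fst d \<le> m" by (auto simp: globe_def)
  then show ?thesis using True by (auto simp: composable_def globe_src_to globe_tgt_to)
qed (auto simp: composable_def)

lemma globe_omega_category: "omega_category (globe n)"
proof -
  have d: "c \<in> cells (globe n) m \<longleftrightarrow> fst c \<le> m \<and> (fst c < n \<or> c = (n, True))"
    "src (globe n) m c = (if fst c \<le> m then c else (m, False))"
    "tgt (globe n) m c = (if fst c \<le> m then c else (m, True))"
    "unit (globe n) m c = c"
    "composite (globe n) m k c c' = (if fst c \<le> k then c' else c)" for m k c c'
    by (auto simp: globe_def)
  show ?thesis
    by (rule omega_category.intro; unfold globe_composable globe_unit_to d)
      (auto simp: globe_src_to globe_tgt_to split: if_splits)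
qed

lemma globe_cells: "(j, b) \<in> cells (globe n) m \<longleftrightarrow> j \<le> m \<and> (j < n \<or> j = n \<and> b)"
  by (simp add: globe_def)

lemma skel_globe_cells: "(j, b) \<in> cells (skel n (globe n)) m \<longleftrightarrow> j \<le> m \<and> j < n"
  unfolding skel_def by (auto simp: globe_unit_to globe_cells)

context omega_category
begin

lemma cell_map_functor:
  assumes x: "x \<in> cells C n"
  shows "omega_functor (globe n) C (cell_map C n x)"
proof -
  interpret G: omega_category "globe n" by (rule globe_omega_category)
  define fc where "fc j b = (if b then tgt_to C n j x else src_to C n j x)" for j b
  have cm: "cell_map C n x k (j, b) = unit_to C j k (fc j b)" for k j b
    by (simp add: cell_map_def fc_def)
  have fc: "fc j b \<in> cells C j" if "j \<le> n" for j b
    using that x by (simp add: fc_def src_to_cell tgt_to_cell)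
  show ?thesis
  proof (unfold_locales, goal_cases)
    case (1 c m)
    then show ?case by (cases c) (auto simp: globe_cells cm fc unit_to_cell)
  next
    case (2 c m)
    obtain j b where c: "c = (j, b)" by (cases c)
    have jn: "j \<le> n" using 2 c by (auto simp: globe_cells)
    show ?case
    proof (cases "j \<le> m")
      case True
      then show ?thesis using 2 c jn by (simp add: globe_def cm src_unit unit_to_cell fc)
    next
      case False
      then have "j = Suc m" using 2 c by (auto simp: globe_cells)
      moreover have "src C m (fc (Suc m) b) = src_to C n m x"
        using src_src_to[OF x, of m] src_tgt_to[OF x, of m] jn calculation 2 c x
        by (cases "Suc m = n") (auto simp: fc_def globe_cells)
      ultimately show ?thesis using c
        by (simp add: cm) (simp add: globe_def cm fc_def)
    qed
  next
    case (3 c m)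
    obtain j b where c: "c = (j, b)" by (cases c)
    have jn: "j \<le> n" using 3 c by (auto simp: globe_cells)
    show ?case
    proof (cases "j \<le> m")
      case True
      then show ?thesis using 3 c jn by (simp add: globe_def cm tgt_unit unit_to_cell fc)
    next
      case False
      then have "j = Suc m" using 3 c by (auto simp: globe_cells)
      moreover have "tgt C m (fc (Suc m) b) = tgt_to C n m x"
        using tgt_tgt_to[OF x, of m] tgt_src_to[OF x, of m] jn calculation 3 c x
        by (cases "Suc m = n") (auto simp: fc_def globe_cells)
      ultimately show ?thesis using c
        by (simp add: cm) (simp add: globe_def cm fc_def)
    qed
  next
    case (4 c m)
    then show ?case by (cases c) (auto simp: globe_cells cm globe_def)
  next
    case (5 m k c d)
    obtain j b i a where c: "c = (j, b)" "d = (i, a)" by (cases c, cases d)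
    have cells: "k < m" "j \<le> n" "i \<le> n" "j \<le> m" "i \<le> m"
      using 5 c by (auto simp: globe_composable globe_cells)
    have uc: "cell_map C n x m c \<in> cells C m" "cell_map C n x m d \<in> cells C m"
      using c cells by (simp_all add: cm unit_to_cell fc)
    show ?case
    proof (cases "j \<le> k")
      case True
      have "cell_map C n x m c = unit_to C k m (tgt_to C m k (cell_map C n x m d))"
        using 5 c True cells
        by (auto simp: globe_composable cm tgt_to_unit_to fc unit_to_unit_to globe_cells
            split: if_splits) (auto simp: fc_def tgt_to_tgt_to tgt_to_src_to x)
      then show ?thesis using unit_left[OF uc(2), of k] cells True c by (simp add: globe_def)
    next
      case False
      have "cell_map C n x m d = unit_to C k m (src_to C m k (cell_map C n x m c))"
        using 5 c False cells
        by (auto simp: globe_composable cm src_to_unit_to fc unit_to_unit_to globe_cells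
            split: if_splits) (auto simp: fc_def src_to_src_to src_to_tgt_to x)
      then show ?thesis using unit_right[OF uc(1), of k] cells False c by (simp add: globe_def)
    qed
  qed
qed

lemma cell_map_principal: "cell_map C n x n (n, True) = x"
  by (simp add: cell_map_def)

lemma cell_map_unique:
  assumes F: "omega_functor (globe n) C F" and c: "c \<in> cells (globe n) m"
  shows "F m c = cell_map C n (F n (n, True)) m c"
proof -
  interpret F: omega_functor "globe n" C F by fact
  obtain j b where jb: "c = (j, b)" by (cases c)
  have e: "(n, True) \<in> cells (globe n) n" and j: "j \<le> n" "j \<le> m" "(j, b) \<in> cells (globe n) j"
    and b: "j = n \<Longrightarrow> b" using c jb by (auto simp: globe_cells)
  have "F j (j, b) = (if b then tgt_to C n j (F n (n, True)) else src_to C n j (F n (n, True)))"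
    using F.map_src_to[OF e j(1)] F.map_tgt_to[OF e j(1)] j b
    by (auto simp: globe_src_to globe_tgt_to split: if_splits)
  then show ?thesis
    using F.map_unit_to[OF j(3,2)] by (simp add: jb globe_unit_to cell_map_def)
qed

lemma cell_map_functor_skel:
  assumes x: "x \<in> cells C n"
  shows "omega_functor (globe n) (skel (Suc n) C) (cell_map C n x)"
  unfolding skel_def
proof (rule omega_functor_restrict_cod[OF cell_map_functor[OF x]], fold skel_def)
  fix m c assume c: "c \<in> cells (globe n) m"
  obtain j b where [simp]: "c = (j, b)" by (cases c)
  show "cell_map C n x m c \<in> {unit_to C j m x | j x. j < Suc n \<and> j \<le> m \<and> x \<in> cells C j}"
    using c x src_to_cell[of x n j] tgt_to_cell[of x n j]
    by (auto simp: cell_map_def globe_cells less_Suc_eq_le intro: less_imp_le)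
qed (rule skel_omega_category)

lemma pair_map_eq_cell_map:
  assumes x: "x \<in> cells C n" and c: "c \<in> cells (skel n (globe n)) m"
  shows "pair_map C (n - 1) (src C (n - 1) x) (tgt C (n - 1) x) m c = cell_map C n x m c"
  using c by (cases c; cases n) (auto simp: pair_map_def cell_map_def skel_globe_cells)

lemma pair_map_functor_skel:
  assumes x: "x \<in> cells C n"
  shows "omega_functor (skel n (globe n)) (skel n C)
    (pair_map C (n - 1) (src C (n - 1) x) (tgt C (n - 1) x))"
proof -
  interpret G: omega_category "globe n" by (rule globe_omega_category)
  interpret Gn: omega_category "skel n (globe n)" by (rule G.skel_omega_category)
  interpret Cn: omega_category "skel n C" by (rule skel_omega_category)
  interpret F: omega_functor "globe n" C "cell_map C n x" by (rule cell_map_functor[OF x])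
  let ?P = "pair_map C (n - 1) (src C (n - 1) x) (tgt C (n - 1) x)"
  have e: "?P m c = cell_map C n x m c" if "c \<in> cells (skel n (globe n)) m" for m c
    by (rule pair_map_eq_cell_map[OF x that])
  have sub: "c \<in> cells (globe n) m" if "c \<in> cells (skel n (globe n)) m" for m c
    using G.skel_sub that by blast
  have cc: "composable (globe n) m k c d" if "composable (skel n (globe n)) m k c d" for m k c d
    using that sub by (auto simp: composable_def) (simp_all add: skel_def)
  have ops: "src (skel m D) = src D" "tgt (skel m D) = tgt D" "unit (skel m D) = unit D"
    "composite (skel m D) = composite D" for m and D :: "'x ocat"
    by (simp_all add: skel_def)
  show ?thesis
  proof (unfold_locales, goal_cases)
    case (1 c m)
    obtain j b where [simp]: "c = (j, b)" by (cases c)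
    have "cell_map C n x m c \<in> {unit_to C j m x | j x. j < n \<and> j \<le> m \<and> x \<in> cells C j}"
      using 1 x src_to_cell[of x n j] tgt_to_cell[of x n j]
      by (auto simp: cell_map_def skel_globe_cells intro: less_imp_le)
    then show ?case using e[OF 1] by (simp add: skel_def)
  next
    case (2 c m)
    then show ?case using e[OF 2] e[OF Gn.src_cell[OF 2]] F.map_src[OF sub[OF 2]]
      by (simp add: ops)
  next
    case (3 c m)
    then show ?case using e[OF 3] e[OF Gn.tgt_cell[OF 3]] F.map_tgt[OF sub[OF 3]]
      by (simp add: ops)
  next
    case (4 c m)
    then show ?case using e[OF 4] e[OF Gn.unit_cell[OF 4]] F.map_unit[OF sub[OF 4]]
      by (simp add: ops)
  next
    case (5 m k c d)
    then show ?case using e[OF Gn.comp_cell[OF 5]] F.map_comp[OF cc[OF 5]]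
        e[of c m] e[of d m] by (simp add: ops composable_def)
  qed
qed

end

lemma copies_functor:
  assumes G: "omega_category G" and D: "omega_category D"
    and H: "\<And>x. x \<in> E \<Longrightarrow> omega_functor G D (H x)"
  shows "omega_functor (copies E G) D (\<lambda>k (x, c). H x k c)"
proof -
  interpret G: omega_category G by fact
  interpret D: omega_category D by fact
  interpret E: omega_category "copies E G" by (rule G.copies_omega_category)
  note [simp] = omega_functor.map_cell[OF H] omega_functor.map_src[OF H]
    omega_functor.map_tgt[OF H] omega_functor.map_unit[OF H] omega_functor.map_comp[OF H]
  show ?thesis
  proof (unfold_locales, goal_cases)
    case (5 n k x y)
    then show ?case by (cases x; cases y) (simp add: G.copies_composable, simp add: copies_def)
  qed (auto simp: copies_def)
qed

lemma basis_square:
  assumes C: "omega_category C" and E: "E \<subseteq> cells C n"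
  shows "omega_functor (copies E (skel n (globe n))) (skel n C)
      (\<lambda>k (x, c). pair_map C (n - 1) (src C (n - 1) x) (tgt C (n - 1) x) k c)"
    and "omega_functor (copies E (skel n (globe n))) (copies E (globe n)) (\<lambda>k xc. xc)"
    and "omega_functor (skel n C) (skel (Suc n) C) (\<lambda>k y. y)"
    and "omega_functor (copies E (globe n)) (skel (Suc n) C) (\<lambda>k (x, c). cell_map C n x k c)"
    and "xc \<in> cells (copies E (skel n (globe n))) k \<Longrightarrow>
      (case xc of (x, c) \<Rightarrow> pair_map C (n - 1) (src C (n - 1) x) (tgt C (n - 1) x) k c) =
      (case xc of (x, c) \<Rightarrow> cell_map C n x k c)"
proof -
  interpret C: omega_category C by fact
  interpret G: omega_category "globe n" by (rule globe_omega_category)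
  show "omega_functor (copies E (skel n (globe n))) (skel n C)
      (\<lambda>k (x, c). pair_map C (n - 1) (src C (n - 1) x) (tgt C (n - 1) x) k c)"
    using E by (intro copies_functor G.skel_omega_category C.skel_omega_category
        C.pair_map_functor_skel) auto
  show "omega_functor (skel n C) (skel (Suc n) C) (\<lambda>k y. y)"
    by (rule C.skel_inclusion) simp
  show "omega_functor (copies E (globe n)) (skel (Suc n) C) (\<lambda>k (x, c). cell_map C n x k c)"
    using E by (intro copies_functor G.omega_category_axioms C.skel_omega_category
        C.cell_map_functor_skel) auto
  have cop: "copies E (skel n (globe n)) =
      copies E (globe n)\<lparr>cells := \<lambda>k. E \<times> cells (skel n (globe n)) k\<rparr>"
    by (simp add: copies_def skel_def)
  show "omega_functor (copies E (skel n (globe n))) (copies E (globe n)) (\<lambda>k xc. xc)"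
    unfolding cop
    by (rule omega_functor_inclusion[OF G.copies_omega_category], fold cop)
      (auto simp: copies_def intro: omega_category.copies_omega_category[OF G.skel_omega_category, unfolded copies_def]
        dest: subsetD[OF G.skel_sub])
  show "(case xc of (x, c) \<Rightarrow> pair_map C (n - 1) (src C (n - 1) x) (tgt C (n - 1) x) k c) =
      (case xc of (x, c) \<Rightarrow> cell_map C n x k c)"
    if "xc \<in> cells (copies E (skel n (globe n))) k"
    using that E C.pair_map_eq_cell_map by (auto simp: copies_def)
qed

end

theory Submission
  imports Defs
begin

text \<open>
  A subset of \<open>C\<^sub>n\<close> is an \<open>n\<close>-basis iff it generates \<open>C\<^sub>n\<close> and functors on the \<open>(n-1)\<close>-skeleton
  extend along prescribed compatible values on it. Let \<open>F : C \<rightarrow> D\<close> be discrete Conduche.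

  If \<open>E\<close> is an \<open>n\<close>-basis of \<open>D\<close>, then \<open>F\<^sup>-\<^sup>1(E)\<close> is one of \<open>C\<close>: decompositions of \<open>F(x)\<close> lift to \<open>x\<close>,
  which gives generation; a functor on \<open>C\<close> with values in \<open>T\<close> is the same as a functor over \<open>D\<close> into the
  omega-category whose \<open>n\<close>-cells over \<open>d\<close> are the families of \<open>n\<close>-cells of \<open>T\<close> indexed by the fibre of \<open>d\<close>
  (the right adjoint to pullback along \<open>F\<close>), so extensions exist because they exist over \<open>D\<close>.

  Conversely, if \<open>F\<close> is surjective and \<open>F\<^sup>-\<^sup>1(E)\<close> is an \<open>n\<close>-basis of \<open>C\<close>, then \<open>E\<close> is one of \<open>D\<close>:
  extensions over \<open>C\<close> are constant on the fibres of \<open>F\<close>, again by lifting decompositions. This applies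
  to the indecomposable cells, because \<open>F\<close> preserves and reflects them and the only possible
  bases of a free omega-category consist of its indecomposable cells.
\<close>

section \<open>Faces of composites\<close>

lemma skel_simps [simp]:
  "src (skel N C) = src C" "tgt (skel N C) = tgt C" "unit (skel N C) = unit C"
  "composite (skel N C) = composite C"
  "src_to (skel N C) m k x = src_to C m k x" "tgt_to (skel N C) m k x = tgt_to C m k x"
  "unit_to (skel N C) k m x = unit_to C k m x"
  by (simp_all add: skel_def)

context omega_category
begin

lemma composable_src:
  "composable C (Suc m) k x y \<Longrightarrow> k < m \<Longrightarrow> composable C m k (src C m x) (src C m y)"
  using tgt_to_src[of y m k] by (simp add: composable_def src_cell)

lemma composable_tgt:
  "composable C (Suc m) k x y \<Longrightarrow> k < m \<Longrightarrow> composable C m k (tgt C m x) (tgt C m y)"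
  using src_to_tgt[of x m k] by (simp add: composable_def tgt_cell)

lemma src_to_comp_low:
  "composable C m k x y \<Longrightarrow> j \<le> k \<Longrightarrow> src_to C m j (composite C m k x y) = src_to C m j y"
proof (induction m arbitrary: x y)
  case (Suc m)
  then have "k \<le> m" by (simp add: composable_def)
  then show ?case
    using Suc composable_src[of m k x y]
    by (cases "k = m") (simp_all add: src_comp_top src_comp)
qed (simp add: composable_def)

lemma tgt_to_comp_low:
  "composable C m k x y \<Longrightarrow> j \<le> k \<Longrightarrow> tgt_to C m j (composite C m k x y) = tgt_to C m j x"
proof (induction m arbitrary: x y)
  case (Suc m)
  then have "k \<le> m" by (simp add: composable_def)
  then show ?case
    using Suc composable_tgt[of m k x y]
    by (cases "k = m") (simp_all add: tgt_comp_top tgt_comp)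
qed (simp add: composable_def)

lemma src_to_comp_high:
  "composable C m k x y \<Longrightarrow> k < j \<Longrightarrow> j \<le> m \<Longrightarrow>
    composable C j k (src_to C m j x) (src_to C m j y) \<and>
    src_to C m j (composite C m k x y) = composite C j k (src_to C m j x) (src_to C m j y)"
proof (induction m arbitrary: x y)
  case (Suc m)
  show ?case
  proof (cases "j = Suc m")
    case False
    then show ?thesis
      using Suc composable_src[of m k x y] by (simp add: src_comp)
  qed (use Suc in simp)
qed (simp add: composable_def)

lemma tgt_to_comp_high:
  "composable C m k x y \<Longrightarrow> k < j \<Longrightarrow> j \<le> m \<Longrightarrow>
    composable C j k (tgt_to C m j x) (tgt_to C m j y) \<and>
    tgt_to C m j (composite C m k x y) = composite C j k (tgt_to C m j x) (tgt_to C m j y)"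
proof (induction m arbitrary: x y)
  case (Suc m)
  show ?case
  proof (cases "j = Suc m")
    case False
    then show ?thesis
      using Suc composable_tgt[of m k x y] by (simp add: tgt_comp)
  qed (use Suc in simp)
qed (simp add: composable_def)

lemma comp_unit_self:
  assumes "z \<in> cells C j" "j \<le> k" "k < m"
  shows "composite C m k (unit_to C j m z) (unit_to C j m z) = unit_to C j m z"
  using unit_left[of "unit_to C j m z" m k] assms
  by (simp add: tgt_to_unit_to unit_to_unit_to unit_to_cell)

text \<open>The \<open>k\<close>-faces of the two cells are iterated units of \<open>z\<close> and
  \<open>w\<close>, which are recovered from them as \<open>j\<close>-sources. So along a dimension
  at least \<open>j\<close> such units compose only with themselves.\<close>

lemma composable_unit_to_top:
  assumes "composable C m k (unit_to C j m z) (unit_to C j m w)"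
    and "z \<in> cells C j" "w \<in> cells C j" "j \<le> k"
  shows "z = w"
proof -
  have "unit_to C j k z = unit_to C j k w"
    using assms src_to_unit_to[of z j m k] tgt_to_unit_to[of w j m k]
    by (simp add: composable_def)
  then have "src_to C k j (unit_to C j k z) = src_to C k j (unit_to C j k w)" by simp
  then show ?thesis using assms by (simp add: src_to_unit_to)
qed

text \<open>An iterated unit of a cell of dimension \<open>j < N\<close> is also an iterated unit of
  an \<open>(N - 1)\<close>-cell, so the generating dimension can be fixed. That \<open>N\<close> is
  positive follows from the existence of \<open>x\<close>.\<close>

lemma skel_top:
  assumes "x \<in> cells (skel N C) m" "N \<le> Suc m"
  obtains M z where "N = Suc M" "M \<le> m" "z \<in> cells C M" "x = unit_to C M m z"
proof -
  obtain j y where y: "x = unit_to C j m y" "j < N" "j \<le> m" "y \<in> cells C j"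
    using assms(1) by (auto simp: skel_def)
  then show thesis
    using assms(2) that[of "N - 1" "unit_to C j (N - 1) y"]
    by (simp add: unit_to_unit_to unit_to_cell)
qed

lemma composable_skel:
  "composable (skel N C) m k x y \<longleftrightarrow>
    composable C m k x y \<and> x \<in> cells (skel N C) m \<and> y \<in> cells (skel N C) m"
  using skel_sub[of N m] by (auto simp: composable_def)

end

section \<open>Functors defined below a dimension\<close>

text \<open>The same data as an omega-functor on \<open>skel N A\<close>, but given only in
  dimensions below \<open>N\<close>, with nothing to check on the units above. Extending by one
  dimension becomes the passage from \<open>n\<close> to \<open>Suc n\<close>.\<close>

locale functor_below = dom: omega_category A + cod: omega_category B
  for A :: "'a ocat" and B :: "'b ocat" +
  fixes N :: nat and F :: "nat \<Rightarrow> 'a \<Rightarrow> 'b"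
  assumes map_cell: "x \<in> cells A m \<Longrightarrow> m < N \<Longrightarrow> F m x \<in> cells B m"
    and map_src: "x \<in> cells A (Suc m) \<Longrightarrow> Suc m < N \<Longrightarrow> F m (src A m x) = src B m (F (Suc m) x)"
    and map_tgt: "x \<in> cells A (Suc m) \<Longrightarrow> Suc m < N \<Longrightarrow> F m (tgt A m x) = tgt B m (F (Suc m) x)"
    and map_unit: "x \<in> cells A m \<Longrightarrow> Suc m < N \<Longrightarrow> F (Suc m) (unit A m x) = unit B m (F m x)"
    and map_comp: "composable A m k x y \<Longrightarrow> m < N \<Longrightarrow>
          F m (composite A m k x y) = composite B m k (F m x) (F m y)"
begin

lemma map_src_to: "x \<in> cells A m \<Longrightarrow> k \<le> m \<Longrightarrow> m < N \<Longrightarrow> F k (src_to A m k x) = src_to B m k (F m x)"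
  by (induction m arbitrary: x) (auto simp: le_Suc_eq map_src dom.src_cell)

lemma map_tgt_to: "x \<in> cells A m \<Longrightarrow> k \<le> m \<Longrightarrow> m < N \<Longrightarrow> F k (tgt_to A m k x) = tgt_to B m k (F m x)"
  by (induction m arbitrary: x) (auto simp: le_Suc_eq map_tgt dom.tgt_cell)

lemma map_unit_to: "x \<in> cells A k \<Longrightarrow> k \<le> m \<Longrightarrow> m < N \<Longrightarrow> F m (unit_to A k m x) = unit_to B k m (F k x)"
  by (induction m) (auto simp: le_Suc_eq map_unit dom.unit_to_cell)

lemma map_composable: "composable A m k x y \<Longrightarrow> m < N \<Longrightarrow> composable B m k (F m x) (F m y)"
  by (auto simp: composable_def map_cell map_src_to[symmetric] map_tgt_to[symmetric])

text \<open>In dimension at least \<open>N\<close> every cell of the skeleton is the iterated unit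
  of its \<open>(N - 1)\<close>-source, which forces its image.\<close>

lemma extends_to_skel:
  obtains h where "omega_functor (skel N A) B h" "\<And>m x. m < N \<Longrightarrow> h m x = F m x"
proof -
  \<comment> \<open>For \<open>N = 0\<close> the subtraction is harmless, since the skeleton has no
    cells.\<close>
  define h where "h m x = (if m < N then F m x
    else unit_to B (N - 1) m (F (N - 1) (src_to A m (N - 1) x)))" for m x
  interpret S: omega_category "skel N A" by (rule dom.skel_omega_category)
  have hu: "h m (unit_to A M m z) = unit_to B M m (F M z)"
    if "N = Suc M" "z \<in> cells A M" "M \<le> m" for m z M
    using that by (cases "m = M") (auto simp: h_def dom.src_to_unit_to)
  have "omega_functor (skel N A) B h"
  proof (unfold_locales, goal_cases)
    case (1 x m)
    show ?case
    proof (cases "m < N")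
      case True
      then show ?thesis using 1 by (simp add: h_def map_cell dom.skel_cells)
    next
      case False
      then obtain M z where "N = Suc M" "M \<le> m" "z \<in> cells A M" "x = unit_to A M m z"
        using dom.skel_top[OF 1] by auto
      then show ?thesis by (simp add: hu map_cell cod.unit_to_cell)
    qed
  next
    case (2 x m)
    show ?case
    proof (cases "Suc m < N")
      case True
      then show ?thesis using 2 by (simp add: h_def map_src dom.skel_cells)
    next
      case False
      then obtain M z where z: "N = Suc M" "M \<le> m" "z \<in> cells A M" "x = unit_to A M (Suc m) z"
        using dom.skel_top[OF 2] by (metis Suc_leI Suc_le_mono le_SucI not_less)
      then show ?thesis using hu[of M z m] hu[of M z "Suc m"]
        by (simp add: dom.src_unit dom.unit_to_cell cod.src_unit cod.unit_to_cell map_cell)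
    qed
  next
    case (3 x m)
    show ?case
    proof (cases "Suc m < N")
      case True
      then show ?thesis using 3 by (simp add: h_def map_tgt dom.skel_cells)
    next
      case False
      then obtain M z where z: "N = Suc M" "M \<le> m" "z \<in> cells A M" "x = unit_to A M (Suc m) z"
        using dom.skel_top[OF 3] by (metis Suc_leI Suc_le_mono le_SucI not_less)
      then show ?thesis using hu[of M z m] hu[of M z "Suc m"]
        by (simp add: dom.tgt_unit dom.unit_to_cell cod.tgt_unit cod.unit_to_cell map_cell)
    qed
  next
    case (4 x m)
    show ?case
    proof (cases "Suc m < N")
      case True
      then show ?thesis using 4 by (simp add: h_def map_unit dom.skel_cells)
    next
      case False
      then obtain M z where z: "N = Suc M" "M \<le> m" "z \<in> cells A M" "x = unit_to A M m z"
        using dom.skel_top[OF 4] by auto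
      then show ?thesis using hu[of M z m] hu[of M z "Suc m"] by simp
    qed
  next
    case (5 m k x y)
    then have c: "composable A m k x y" "x \<in> cells (skel N A) m" "y \<in> cells (skel N A) m"
      by (simp_all add: dom.composable_skel)
    show ?case
    proof (cases "m < N")
      case True
      then show ?thesis using c by (simp add: h_def map_comp)
    next
      case False
      then have N: "N \<le> Suc m" by simp
      obtain M z where z: "N = Suc M" "M \<le> m" "z \<in> cells A M" "x = unit_to A M m z"
        by (rule dom.skel_top[OF c(2) N])
      obtain w where w: "w \<in> cells A M" "y = unit_to A M m w"
        by (rule dom.skel_top[OF c(3) N]) (use z in simp)
      have km: "k < m" using c by (simp add: composable_def)
      show ?thesis
      proof (cases "k < M")
        case True
        then have zw: "composable A M k z w"
          using c(1) z w dom.src_to_unit_to[of z M m k] dom.tgt_to_unit_to[of w M m k]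
          by (simp add: composable_def)
        have "h m (unit_to A M m (composite A M k z w)) =
            unit_to B M m (composite B M k (F M z) (F M w))"
          using hu[OF z(1) dom.comp_cell[OF zw] z(2)] z map_comp[OF zw] by simp
        also have "\<dots> = composite B m k (h m x) (h m y)"
          using cod.unit_to_comp[OF map_composable[OF zw] z(2)] z w hu by simp
        finally show ?thesis using dom.unit_to_comp[OF zw] z w by simp
      next
        \<comment> \<open>No composition takes place in dimension \<open>M\<close>: the two units
          coincide.\<close>
        case k: False
        then have "z = w" using dom.composable_unit_to_top[of m k M z w] c z w by simp
        then show ?thesis
          using z w k km hu[OF z(1,3,2)] dom.comp_unit_self[of z M k m]
            cod.comp_unit_self[of "F M z" M k m] by (simp add: map_cell)
      qed
    qed
  qed
  then show thesis using that by (simp add: h_def)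
qed

end

lemma omega_functor_below:
  assumes h: "omega_functor (skel N A) B h" and A: "omega_category A"
  shows "functor_below A B N h"
proof -
  interpret omega_category A by fact
  interpret h: omega_functor "skel N A" B h by fact
  show ?thesis
  proof (unfold_locales, goal_cases)
    case (1 x m)
    then show ?case using h.map_cell by (simp add: skel_cells)
  next
    case (2 x m)
    then show ?case using h.map_src[of x m] by (simp add: skel_cells)
  next
    case (3 x m)
    then show ?case using h.map_tgt[of x m] by (simp add: skel_cells)
  next
    case (4 x m)
    then show ?case using h.map_unit[of x m] by (simp add: skel_cells)
  next
    case (5 m k x y)
    then show ?case using h.map_comp[of m k x y]
      by (simp add: composable_skel) (simp add: skel_cells composable_def)
  qed
qed

lemma skel_functor_eqI:
  assumes h: "omega_functor (skel N A) B h" and h': "omega_functor (skel N A) B h'"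
    and A: "omega_category A"
    and eq: "\<And>m x. m < N \<Longrightarrow> x \<in> cells A m \<Longrightarrow> h m x = h' m x"
    and x: "x \<in> cells (skel N A) m"
  shows "h m x = h' m x"
proof -
  interpret omega_category A by fact
  interpret h: omega_functor "skel N A" B h by fact
  interpret h': omega_functor "skel N A" B h' by fact
  obtain j z where z: "x = unit_to A j m z" "j < N" "j \<le> m" "z \<in> cells A j"
    using x by (auto simp: skel_def)
  then show ?thesis
    using h.map_unit_to[of z j m] h'.map_unit_to[of z j m] eq by (simp add: skel_cells)
qed

section \<open>Bases in terms of generation and extension\<close>

text \<open>All \<open>(n - 1)\<close>-cells are available through their units, so only new
  \<open>n\<close>-cells have to come from \<open>E\<close>. For \<open>n = 0\<close> there are
  neither units nor composites, and the set is \<open>E\<close>.\<close>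

inductive_set generated :: "'a ocat \<Rightarrow> nat \<Rightarrow> 'a set \<Rightarrow> 'a set" for C n E where
  unit: "n = Suc m \<Longrightarrow> z \<in> cells C m \<Longrightarrow> unit C m z \<in> generated C n E"
| basis: "e \<in> E \<Longrightarrow> e \<in> generated C n E"
| comp: "composable C n k x y \<Longrightarrow> x \<in> generated C n E \<Longrightarrow> y \<in> generated C n E \<Longrightarrow>
    composite C n k x y \<in> generated C n E"

text \<open>The uniqueness half of the pushout property, freed from skeleta and globes. Agreement on
  \<open>E\<close> suffices because a functor from a globe is determined by its value at the
  principal cell.\<close>

lemma basis_functor_eqI:
  fixes T :: "'t ocat"
  assumes b: "is_basis C n E" and C: "omega_category C"
    and h: "functor_below C T (Suc n) h" and h': "functor_below C T (Suc n) h'"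
    and low: "\<And>m x. m < n \<Longrightarrow> x \<in> cells C m \<Longrightarrow> h m x = h' m x"
    and gen: "\<And>e. e \<in> E \<Longrightarrow> h n e = h' n e"
    and x: "x \<in> cells C n"
  shows "h n x = h' n x"
proof -
  interpret omega_category C by fact
  obtain H where H: "omega_functor (skel (Suc n) C) T H" "\<And>m x. m < Suc n \<Longrightarrow> H m x = h m x"
    using functor_below.extends_to_skel[OF h] by metis
  obtain H' where H': "omega_functor (skel (Suc n) C) T H'" "\<And>m x. m < Suc n \<Longrightarrow> H' m x = h' m x"
    using functor_below.extends_to_skel[OF h'] by metis
  interpret H: omega_functor "skel (Suc n) C" T H by fact
  interpret H': omega_functor "skel (Suc n) C" T H' by fact
  have E: "E \<subseteq> cells C n" using b by (simp add: is_basis_def)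
  note sq = basis_square[OF C E]
  note coc = cocartesian_all_types[OF b[unfolded is_basis_def, THEN conjunct2], where 't = 't,
      unfolded cocartesian_for_def]
  have p: "omega_functor (skel n C) T H" "omega_functor (skel n C) T H'"
    using omega_functor_comp[OF sq(3) H(1)] omega_functor_comp[OF sq(3) H'(1)] by simp_all
  have q: "omega_functor (copies E (globe n)) T (\<lambda>k xc. H k (case xc of (x, c) \<Rightarrow> cell_map C n x k c))"
    using omega_functor_comp[OF sq(4) H(1)] by simp
  have qq: "H' k (case xc of (x, c) \<Rightarrow> cell_map C n x k c) = H k (case xc of (x, c) \<Rightarrow> cell_map C n x k c)"
    if xc: "xc \<in> cells (copies E (globe n)) k" for k xc
  proof -
    obtain e c where "xc = (e, c)" by (cases xc)
    then have e: "xc = (e, c)" "e \<in> E" "c \<in> cells (globe n) k"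
      using xc by (auto simp: copies_def)
    have K: "omega_functor (globe n) T (\<lambda>k c. H k (cell_map C n e k c))"
      "omega_functor (globe n) T (\<lambda>k c. H' k (cell_map C n e k c))"
      using omega_functor_comp[OF cell_map_functor_skel H(1)]
        omega_functor_comp[OF cell_map_functor_skel H'(1)] e E by blast+
    show ?thesis
      using H.cod.cell_map_unique[OF K(1) e(3)] H.cod.cell_map_unique[OF K(2) e(3)] e gen
      by (simp add: cell_map_principal H H')
  qed
  have comm: "\<forall>k. \<forall>x\<in>cells (copies E (skel n (globe n))) k.
      H k (case x of (x, c) \<Rightarrow> pair_map C (n - 1) (src C (n - 1) x) (tgt C (n - 1) x) k c) =
      H k (case x of (x, c) \<Rightarrow> cell_map C n x k c)"
    using sq(5) by simp
  \<comment> \<open>\<open>g\<close> is the mediating functor for the cocone induced by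
    \<open>H\<close>. As \<open>H'\<close> induces the same cocone, both equal
    \<open>g\<close>.\<close>
  obtain g where g: "\<And>h'. omega_functor (skel (Suc n) C) T h' \<Longrightarrow>
      (\<forall>k. \<forall>y\<in>cells (skel n C) k. h' k y = H k y) \<Longrightarrow>
      (\<forall>k. \<forall>z\<in>cells (copies E (globe n)) k. h' k (case z of (x, c) \<Rightarrow> cell_map C n x k c) =
         H k (case z of (x, c) \<Rightarrow> cell_map C n x k c)) \<Longrightarrow>
      (\<forall>k. \<forall>w\<in>cells (skel (Suc n) C) k. h' k w = g k w)"
    using coc[THEN conjunct2, THEN conjunct2, THEN conjunct2, THEN conjunct2, THEN conjunct2,
      THEN spec, THEN spec, THEN spec, THEN mp, OF conjI, OF _ conjI, OF p(1) q comm] by blast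
  have low': "H' k y = H k y" if "y \<in> cells (skel n C) k" for k y
    using skel_functor_eqI[OF p(2) p(1) C _ that] low H H' by simp
  have "H' n x = g n x" "H n x = g n x"
    using g[OF H(1)] g[OF H'(1)] low' qq x by (simp_all add: skel_cells)
  then show ?thesis using H H' by simp
qed

text \<open>The existence half of the pushout property. The boundary conditions on \<open>q\<close>
  give compatibility with \<open>p\<close> on the spheres; the premise \<open>n = Suc m\<close>
  makes them void for \<open>n = 0\<close>.\<close>

lemma basis_extension:
  fixes T :: "'t ocat"
  assumes b: "is_basis C n E" and p: "functor_below C T n p"
    and q: "\<And>e. e \<in> E \<Longrightarrow> q e \<in> cells T n"
    and q_src: "\<And>e m. e \<in> E \<Longrightarrow> n = Suc m \<Longrightarrow> src T m (q e) = p m (src C m e)"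
    and q_tgt: "\<And>e m. e \<in> E \<Longrightarrow> n = Suc m \<Longrightarrow> tgt T m (q e) = p m (tgt C m e)"
  obtains h where "functor_below C T (Suc n) h"
    "\<And>m x. m < n \<Longrightarrow> x \<in> cells C m \<Longrightarrow> h m x = p m x" "\<And>e. e \<in> E \<Longrightarrow> h n e = q e"
proof -
  interpret p: functor_below C T n p by fact
  obtain P where P: "omega_functor (skel n C) T P" "\<And>m x. m < n \<Longrightarrow> P m x = p m x"
    using p.extends_to_skel by metis
  interpret P: omega_functor "skel n C" T P by fact
  define Q where "Q k = (\<lambda>(x, c). cell_map T n (q x) k c)" for k
  have E: "E \<subseteq> cells C n" using b by (simp add: is_basis_def)
  note coc = cocartesian_all_types[OF b[unfolded is_basis_def, THEN conjunct2], where 't = 't,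
      unfolded cocartesian_for_def]
  have Q: "omega_functor (copies E (globe n)) T Q"
    unfolding Q_def using q
    by (intro copies_functor globe_omega_category p.cod.omega_category_axioms p.cod.cell_map_functor)
  have PQ: "P k (case xc of (x, c) \<Rightarrow> pair_map C (n - 1) (src C (n - 1) x) (tgt C (n - 1) x) k c) = Q k xc"
    if xc: "xc \<in> cells (copies E (skel n (globe n))) k" for k xc
  proof -
    obtain e j a where e: "xc = (e, (j, a))" "e \<in> E" "j \<le> k" "j < n"
      using xc by (auto simp: copies_def skel_globe_cells)
    obtain m where m: "n = Suc m" "j \<le> m" using e by (cases n) auto
    have ec: "e \<in> cells C (Suc m)" using e E m by auto
    have f: "src_to C m j (src C m e) \<in> cells C j" "tgt_to C m j (tgt C m e) \<in> cells C j"
      using m ec by (simp_all add: p.dom.src_cell p.dom.tgt_cell p.dom.src_to_cell p.dom.tgt_to_cell)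
    have pf: "p j (src_to C m j (src C m e)) = src_to T m j (src T m (q e))"
      "p j (tgt_to C m j (tgt C m e)) = tgt_to T m j (tgt T m (q e))"
      using m ec e p.map_src_to[of "src C m e" m j] p.map_tgt_to[of "tgt C m e" m j] q_src q_tgt
      by (simp_all add: p.dom.src_cell p.dom.tgt_cell)
    show ?thesis
      using m e f pf P.map_unit_to[of _ j k] P(2)[of j]
      by (simp add: Q_def pair_map_def cell_map_def p.dom.skel_cells)
  qed
  obtain H where H: "omega_functor (skel (Suc n) C) T H"
      "\<forall>k. \<forall>y\<in>cells (skel n C) k. H k y = P k y"
      "\<forall>k. \<forall>z\<in>cells (copies E (globe n)) k. H k (case z of (x, c) \<Rightarrow> cell_map C n x k c) = Q k z"
    using coc[THEN conjunct2, THEN conjunct2, THEN conjunct2, THEN conjunct2, THEN conjunct2,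
      THEN spec, THEN spec, THEN spec, THEN mp, OF conjI, OF _ conjI, OF P(1) Q] PQ by blast
  show thesis
  proof
    show "functor_below C T (Suc n) H"
      by (rule omega_functor_below[OF H(1) p.dom.omega_category_axioms])
    show "H m x = p m x" if "m < n" "x \<in> cells C m" for m x
      using H(2) that P(2) by (simp add: p.dom.skel_cells)
    show "H n e = q e" if "e \<in> E" for e
    proof -
      have "(e, (n, True)) \<in> cells (copies E (globe n)) n"
        using that by (simp add: copies_def globe_cells)
      then have "H n (cell_map C n e n (n, True)) = Q n (e, (n, True))" using H(3) by fastforce
      then show ?thesis by (simp add: p.dom.cell_map_principal p.cod.cell_map_principal Q_def)
    qed
  qed
qed

text \<open>The inclusion of the lower cells and of \<open>E\<close> into the subcategory
  \<open>S\<close> of cells with generated \<open>n\<close>-faces extends to all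
  \<open>n\<close>-cells of \<open>C\<close>. Followed by the inclusion into \<open>C\<close> the
  extension is the identity by uniqueness, so every \<open>n\<close>-cell lies in
  \<open>S\<close>.\<close>

lemma basis_generates:
  assumes b: "is_basis C n E" and C: "omega_category C"
  shows "cells C n \<subseteq> generated C n E"
proof
  fix x assume x: "x \<in> cells C n"
  interpret omega_category C by fact
  let ?G = "generated C n E"
  have E: "E \<subseteq> cells C n" using b by (simp add: is_basis_def)
  \<comment> \<open>There is no condition below dimension \<open>n\<close>, and in dimension
    \<open>n\<close> the cell itself must be generated. Above \<open>n\<close> the condition on both
    faces makes \<open>S\<close> closed under source and target.\<close>
  define S where "S m = {x \<in> cells C m. n \<le> m \<longrightarrow> src_to C m n x \<in> ?G \<and> tgt_to C m n x \<in> ?G}" for m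
  have "omega_category (C\<lparr>cells := S\<rparr>)"
  proof (rule subcategory, goal_cases)
    case (2 m x)
    then show ?case
      using tgt_to_src[of x m n] by (cases "m = n") (auto simp: S_def src_cell)
  next
    case (3 m x)
    then show ?case
      using src_to_tgt[of x m n] by (cases "m = n") (auto simp: S_def tgt_cell)
  next
    case (4 m x)
    show ?case
    proof (cases "n = Suc m")
      case True
      then show ?thesis using 4 by (auto simp: S_def unit_cell generated.unit)
    next
      case False
      then show ?thesis using 4 by (auto simp: S_def unit_cell src_unit tgt_unit le_Suc_eq)
    qed
  next
    case (5 m k x y)
    have "src_to C m n (composite C m k x y) \<in> ?G \<and> tgt_to C m n (composite C m k x y) \<in> ?G"
      if "n \<le> m"
    proof (cases "k < n")
      case True
      then show ?thesis
        using src_to_comp_high[OF 5(1)] tgt_to_comp_high[OF 5(1)] that 5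
        by (auto simp: S_def intro: generated.comp)
    next
      case False
      then show ?thesis
        using src_to_comp_low[OF 5(1)] tgt_to_comp_low[OF 5(1)] that 5 by (simp add: S_def)
    qed
    then show ?case using comp_cell[OF 5(1)] by (simp add: S_def)
  qed (auto simp: S_def)
  then interpret S: omega_category "C\<lparr>cells := S\<rparr>" .
  have "functor_below C (C\<lparr>cells := S\<rparr>) n (\<lambda>m x. x)"
    by unfold_locales (auto simp: S_def)
  then obtain h where h: "functor_below C (C\<lparr>cells := S\<rparr>) (Suc n) h"
    "\<And>m x. m < n \<Longrightarrow> x \<in> cells C m \<Longrightarrow> h m x = x" "\<And>e. e \<in> E \<Longrightarrow> h n e = e"
  proof (rule basis_extension[OF b, where q = "\<lambda>e. e"])
    show "e \<in> cells (C\<lparr>cells := S\<rparr>) n" if "e \<in> E" for e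
      using that E by (auto simp: S_def generated.basis)
  qed (use that in auto)
  interpret h: functor_below C "C\<lparr>cells := S\<rparr>" "Suc n" h by fact
  have hC: "functor_below C C (Suc n) h"
    using h.map_cell h.map_src h.map_tgt h.map_unit h.map_comp
    by unfold_locales (auto simp: S_def)
  have "functor_below C C (Suc n) (\<lambda>m x. x)" by unfold_locales auto
  from basis_functor_eqI[OF b C hC this h(2,3) x] have "h n x = x" .
  then show "x \<in> ?G" using h.map_cell[OF x] by (simp add: S_def)
qed

text \<open>Generation yields uniqueness of the mediating functor and \<open>ext\<close> its
  existence. The cell type of \<open>T\<close> is the one over which \<open>cocartesian\<close>
  tests this square.\<close>

lemma is_basisI:
  fixes C :: "'a ocat"
  assumes C: "omega_category C" and E: "E \<subseteq> cells C n" and gen: "cells C n \<subseteq> generated C n E"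
    and ext: "\<And>(T :: (nat + ('a + 'a \<times> nat \<times> bool + 'a)) list ocat) p q.
      functor_below C T n p \<Longrightarrow> (\<And>e. e \<in> E \<Longrightarrow> q e \<in> cells T n) \<Longrightarrow>
      (\<And>e m. e \<in> E \<Longrightarrow> n = Suc m \<Longrightarrow> src T m (q e) = p m (src C m e)) \<Longrightarrow>
      (\<And>e m. e \<in> E \<Longrightarrow> n = Suc m \<Longrightarrow> tgt T m (q e) = p m (tgt C m e)) \<Longrightarrow>
      \<exists>h. functor_below C T (Suc n) h \<and> (\<forall>m<n. \<forall>x\<in>cells C m. h m x = p m x) \<and> (\<forall>e\<in>E. h n e = q e)"
  shows "is_basis C n E"
proof -
  interpret omega_category C by fact
  note sq = basis_square[OF C E]
  have main: "\<exists>h. omega_functor (skel (Suc n) C) T h \<and>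
         (\<forall>k. \<forall>y\<in>cells (skel n C) k. h k y = p k y) \<and>
         (\<forall>k. \<forall>z\<in>cells (copies E (globe n)) k. h k (case z of (x, c) \<Rightarrow> cell_map C n x k c) = q k z) \<and>
         (\<forall>h'. omega_functor (skel (Suc n) C) T h' \<and>
               (\<forall>k. \<forall>y\<in>cells (skel n C) k. h' k y = p k y) \<and>
               (\<forall>k. \<forall>z\<in>cells (copies E (globe n)) k.
                  h' k (case z of (x, c) \<Rightarrow> cell_map C n x k c) = q k z) \<longrightarrow>
               (\<forall>k. \<forall>w\<in>cells (skel (Suc n) C) k. h' k w = h k w))"
    if p: "omega_functor (skel n C) T p" and q: "omega_functor (copies E (globe n)) T q"
      and pq: "\<forall>k. \<forall>x\<in>cells (copies E (skel n (globe n))) k.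
        p k (case x of (x, c) \<Rightarrow> pair_map C (n - 1) (src C (n - 1) x) (tgt C (n - 1) x) k c) = q k x"
    for T :: "(nat + ('a + 'a \<times> nat \<times> bool + 'a)) list ocat" and p q
  proof -
    interpret p: omega_functor "skel n C" T p by fact
    interpret q: omega_functor "copies E (globe n)" T q by fact
    interpret pb: functor_below C T n p by (rule omega_functor_below[OF p C])
    define q' where "q' e = q n (e, (n, True))" for e
    have q': "q' e \<in> cells T n" if "e \<in> E" for e
      using q.map_cell[of "(e, (n, True))" n] that by (simp add: q'_def copies_def globe_cells)
    have q_src: "src T m (q' e) = p m (src C m e)" and q_tgt: "tgt T m (q' e) = p m (tgt C m e)"
      if e: "e \<in> E" and m: "n = Suc m" for e m
    proof -
      have c: "(e, (Suc m, True)) \<in> cells (copies E (globe (Suc m))) (Suc m)"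
        using e by (simp add: copies_def globe_cells)
      \<comment> \<open>At the two \<open>m\<close>-faces of the principal cell, \<open>q\<close> is
        dictated by \<open>p\<close>.\<close>
      have "p m (pair_map C m (src C m e) (tgt C m e) m (m, b)) = q m (e, (m, b))" for b
        using pq[rule_format, of "(e, (m, b))" m] e m by (simp add: copies_def skel_globe_cells)
      from this[of False] this[of True]
      show "src T m (q' e) = p m (src C m e)" "tgt T m (q' e) = p m (tgt C m e)"
        using q.map_src[of "(e, (n, True))" m] q.map_tgt[of "(e, (n, True))" m] c m
        by (simp_all add: q'_def pair_map_def copies_def) (simp_all add: globe_def)
    qed
    obtain h where h: "functor_below C T (Suc n) h" "\<And>m x. m < n \<Longrightarrow> x \<in> cells C m \<Longrightarrow> h m x = p m x"
      "\<And>e. e \<in> E \<Longrightarrow> h n e = q' e"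
      using ext[OF pb.functor_below_axioms q' q_src q_tgt] by blast
    obtain H where H: "omega_functor (skel (Suc n) C) T H" "\<And>m x. m < Suc n \<Longrightarrow> H m x = h m x"
      using functor_below.extends_to_skel[OF h(1)] by metis
    have low: "H k y = p k y" if "y \<in> cells (skel n C) k" for k y
    proof -
      have "omega_functor (skel n C) T H" using omega_functor_comp[OF sq(3) H(1)] by simp
      from skel_functor_eqI[OF this p C _ that] show ?thesis using H(2) h(2) by simp
    qed
    have top: "H k (case z of (x, c) \<Rightarrow> cell_map C n x k c) = q k z"
      if "z \<in> cells (copies E (globe n)) k" for k z
    proof -
      obtain e c where "z = (e, c)" by (cases z)
      then have e: "z = (e, c)" "e \<in> E" "c \<in> cells (globe n) k"
        using that by (auto simp: copies_def)
      have K: "omega_functor (globe n) T (\<lambda>k c. H k (cell_map C n e k c))"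
        using omega_functor_comp[OF cell_map_functor_skel H(1)] e E by blast
      interpret G: omega_category "globe n" by (rule globe_omega_category)
      have L: "omega_functor (globe n) T (\<lambda>k c. q k (e, c))"
      proof (unfold_locales, goal_cases)
        case (1 x n)
        then show ?case using q.map_cell[of "(e, x)"] e by (simp add: copies_def)
      next
        case (2 x n)
        then show ?case using q.map_src[of "(e, x)"] e by (simp add: copies_def)
      next
        case (3 x n)
        then show ?case using q.map_tgt[of "(e, x)"] e by (simp add: copies_def)
      next
        case (4 x n)
        then show ?case using q.map_unit[of "(e, x)"] e by (simp add: copies_def)
      next
        case (5 n k x y)
        then show ?case using q.map_comp[of _ _ "(e, x)" "(e, y)"] e
          by (simp add: G.copies_composable) (simp add: copies_def)
      qed
      show ?thesis
        using p.cod.cell_map_unique[OF K e(3)] p.cod.cell_map_unique[OF L e(3)] e H(2) h(3)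
        by (simp add: cell_map_principal q'_def)
    qed
    have unique: "h' k w = H k w" if h': "omega_functor (skel (Suc n) C) T h'"
      and p': "\<forall>k. \<forall>y\<in>cells (skel n C) k. h' k y = p k y"
      and q'': "\<forall>k. \<forall>z\<in>cells (copies E (globe n)) k.
        h' k (case z of (x, c) \<Rightarrow> cell_map C n x k c) = q k z"
      and w: "w \<in> cells (skel (Suc n) C) k" for h' k w
    proof (rule skel_functor_eqI[OF h' H(1) C _ w])
      interpret h': functor_below C T "Suc n" h' by (rule omega_functor_below[OF h' C])
      interpret H: functor_below C T "Suc n" H by (rule omega_functor_below[OF H(1) C])
      have low': "h' m x = H m x" if "m < n" "x \<in> cells C m" for m x
        using that p' low by (simp add: skel_cells)
      have E': "h' n e = H n e" if "e \<in> E" for e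
      proof -
        have "(e, (n, True)) \<in> cells (copies E (globe n)) n"
          using that by (simp add: copies_def globe_cells)
        then have "h' n (cell_map C n e n (n, True)) = q n (e, (n, True))" using q'' by fastforce
        then show ?thesis using H(2) h(3)[OF that] by (simp add: cell_map_principal q'_def)
      qed
      have "h' n x = H n x" if "x \<in> generated C n E" for x
        using that
      proof induction
        case (unit m z)
        then show ?case using h'.map_unit[of z m] H.map_unit[of z m] low'[of m z] by simp
      next
        case (comp k x y)
        then show ?case using h'.map_comp[of n k x y] H.map_comp[of n k x y] by simp
      qed (rule E')
      then show "h' m x = H m x" if "m < Suc n" "x \<in> cells C m" for m x
        using that low' gen by (cases "m = n") auto
    qed
    show ?thesis using H(1) low top unique by blast
  qed
  show ?thesis
    unfolding is_basis_def cocartesian_def cocartesian_for_def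
    using E sq main by auto
qed

section \<open>Indecomposable cells\<close>

text \<open>Only a factor that is an iterated unit of a \<open>k\<close>-cell makes a factorisation
  along \<open>k\<close> trivial; composing with any other unit is a proper whiskering. Every 0-cell
  is indecomposable.\<close>

definition indecomposable :: "'a ocat \<Rightarrow> nat \<Rightarrow> 'a \<Rightarrow> bool" where
  "indecomposable C n x \<longleftrightarrow> x \<in> cells C n \<and>
     (\<forall>m z. n = Suc m \<longrightarrow> z \<in> cells C m \<longrightarrow> x \<noteq> unit C m z) \<and>
     (\<forall>k a b. composable C n k a b \<longrightarrow> x = composite C n k a b \<longrightarrow>
        a \<in> unit_to C k n ` cells C k \<or> b \<in> unit_to C k n ` cells C k)"

context omega_category
begin

lemma comp_unit_to_left:
  assumes "composable C n k a b" "a \<in> unit_to C k n ` cells C k"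
  shows "composite C n k a b = b"
proof -
  have "a = unit_to C k n (tgt_to C n k b)"
    using assms by (auto simp: composable_def src_to_unit_to)
  then show ?thesis using unit_left[of b n k] assms by (simp add: composable_def)
qed

lemma comp_unit_to_right:
  assumes "composable C n k a b" "b \<in> unit_to C k n ` cells C k"
  shows "composite C n k a b = a"
proof -
  have "b = unit_to C k n (src_to C n k a)"
    using assms by (auto simp: composable_def tgt_to_unit_to)
  then show ?thesis using unit_right[of a n k] assms by (simp add: composable_def)
qed

end

text \<open>
  The target for counting \<open>n\<close>-cells: trivial below dimension \<open>n\<close>, the additive monoid \<open>nat\<close> in
  dimension \<open>n\<close>, and only units above it.
\<close>

definition counting :: "nat \<Rightarrow> nat ocat" where
  "counting n =
     \<lparr>cells = (\<lambda>m. if m < n then {0} else UNIV),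
      src = (\<lambda>m x. if m < n then 0 else x),
      tgt = (\<lambda>m x. if m < n then 0 else x),
      unit = (\<lambda>m x. x),
      composite = (\<lambda>m k x y. if k < n then x + y else x)\<rparr>"

lemma counting_src_to:
  "x \<in> cells (counting n) m \<Longrightarrow> k \<le> m \<Longrightarrow> src_to (counting n) m k x = (if k < n then 0 else x)"
  by (induction m arbitrary: x) (auto simp: counting_def le_Suc_eq split: if_splits)

lemma counting_tgt_to:
  "x \<in> cells (counting n) m \<Longrightarrow> k \<le> m \<Longrightarrow> tgt_to (counting n) m k x = (if k < n then 0 else x)"
  by (induction m arbitrary: x) (auto simp: counting_def le_Suc_eq split: if_splits)

lemma counting_unit_to: "unit_to (counting n) k m x = x"
  by (induction m) (auto simp: counting_def)

lemma counting_composable: "composable (counting n) m k x y \<longleftrightarrow>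
    k < m \<and> x \<in> cells (counting n) m \<and> y \<in> cells (counting n) m \<and> (n \<le> k \<longrightarrow> x = y)"
  by (auto simp: composable_def counting_src_to counting_tgt_to)

lemma counting_omega_category: "omega_category (counting n)"
proof -
  have d: "x \<in> cells (counting n) m \<longleftrightarrow> (m < n \<longrightarrow> x = 0)"
    "src (counting n) m x = (if m < n then 0 else x)"
    "tgt (counting n) m x = (if m < n then 0 else x)"
    "unit (counting n) m x = x"
    "composite (counting n) m k x y = (if k < n then x + y else x)" for m k x y
    by (auto simp: counting_def)
  show ?thesis
    by (rule omega_category.intro; unfold counting_composable counting_unit_to d)
      (auto simp: counting_src_to counting_tgt_to d)
qed

section \<open>Weights and factorisation into indecomposable cells\<close>

definition additive_weight :: "'a ocat \<Rightarrow> nat \<Rightarrow> ('a \<Rightarrow> nat) \<Rightarrow> bool" where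
  "additive_weight C n l \<longleftrightarrow>
     (\<forall>k a b. composable C n k a b \<longrightarrow> l (composite C n k a b) = l a + l b) \<and>
     (\<forall>m z. n = Suc m \<longrightarrow> z \<in> cells C m \<longrightarrow> l (unit C m z) = 0)"

text \<open>Obtained from a functor into \<open>counting n\<close> that vanishes below dimension
  \<open>n\<close>. All boundary conditions hold trivially there, so the values on \<open>E\<close>
  may be arbitrary.\<close>

lemma basis_weight:
  assumes C: "omega_category C" and b: "is_basis C n E"
  obtains l where "additive_weight C n l" "\<And>e. e \<in> E \<Longrightarrow> l e = w e"
proof -
  interpret omega_category C by fact
  interpret N: omega_category "counting n" by (rule counting_omega_category)
  have p: "functor_below C (counting n) n (\<lambda>m x. 0)"
    by unfold_locales (auto simp: counting_def)
  obtain h where h: "functor_below C (counting n) (Suc n) h"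
    "\<And>m x. m < n \<Longrightarrow> x \<in> cells C m \<Longrightarrow> h m x = 0" "\<And>e. e \<in> E \<Longrightarrow> h n e = w e"
    by (rule basis_extension[OF b p, of w]) (auto simp: counting_def)
  interpret h: functor_below C "counting n" "Suc n" h by fact
  have "h n (composite C n k a b) = h n a + h n b" if "composable C n k a b" for k a b
    using h.map_comp[OF that] that by (simp add: counting_def composable_def)
  moreover have "h (Suc m) (unit C m z) = 0" if "n = Suc m" "z \<in> cells C m" for m z
    using h.map_unit[of z m] that h(2)[of m z] by (simp add: counting_def)
  ultimately show thesis
    using that[of "h n"] h(3) by (auto simp: additive_weight_def)
qed

text \<open>Weights are natural numbers, so both factors of a composite of weight 0 have weight 0
  and are units by induction.\<close>

lemma weight_zero_imp_unit:
  assumes C: "omega_category C" and l: "additive_weight C n l" and pos: "\<And>e. e \<in> E \<Longrightarrow> 0 < l e"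
    and x: "x \<in> generated C n E" and "l x = 0"
  shows "\<exists>m z. n = Suc m \<and> z \<in> cells C m \<and> x = unit C m z"
  using x \<open>l x = 0\<close>
proof induction
  case (basis e)
  then show ?case using pos by force
next
  case (comp k x y)
  interpret omega_category C by fact
  have "l x = 0" "l y = 0" using comp l by (auto simp: additive_weight_def)
  then obtain m z w where m: "n = Suc m" and z: "z \<in> cells C m" "x = unit C m z"
    and w: "w \<in> cells C m" "y = unit C m w"
    using comp by auto
  show ?case
  proof (cases "k < m")
    case True
    have "composable C m k z w"
      using composable_src[of m k x y] comp(1) True m z w by (simp add: src_unit)
    then show ?thesis using unit_comp[of m k z w] comp_cell[of m k z w] m z w by auto
  next
    \<comment> \<open>Here \<open>k = m\<close>, and the unit \<open>x\<close> is neutral for this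
      composition.\<close>
    case False
    then have "x = unit_to C k n z" "z \<in> cells C k"
      using comp(1) m z by (auto simp: composable_def less_Suc_eq)
    then have "composite C n k x y = y" using comp_unit_to_left[OF comp(1)] by blast
    then show ?thesis using m w by auto
  qed
qed blast

text \<open>The first entry at which the lists of values differ lies in \<open>fs\<close> and
  decreases, which decides the lexicographic comparison.\<close>

lemma in_measures_append:
  assumes "\<And>f. f \<in> set fs \<Longrightarrow> f x \<le> f y" and "\<exists>f\<in>set fs. f x < f y"
  shows "(x, y) \<in> measures (fs @ gs)"
  using assms by (induction fs) (auto simp: le_less)

text \<open>Descending from \<open>n\<close>: if the \<open>(j + 1)\<close>-dimensional source of
  \<open>a\<close> is a unit, it is the unit on the \<open>j\<close>-dimensional source.\<close>

lemma unit_to_if_faces_units: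
  assumes "omega_category C" and a: "a \<in> cells C n" and k: "k \<le> n"
    and units: "\<And>j. k \<le> j \<Longrightarrow> j < n \<Longrightarrow>
      \<exists>z\<in>cells C j. src_to C n (Suc j) a = unit C j z"
  shows "a \<in> unit_to C k n ` cells C k"
proof -
  interpret omega_category C by fact
  have "a = unit_to C k n (src_to C n k a)"
    using k
  proof (induction rule: inc_induct)
    case (step j)
    obtain z where z: "z \<in> cells C j" "src_to C n (Suc j) a = unit C j z"
      using units[of j] step by auto
    have "src_to C n j a = z"
      using src_src_to[OF a, of j] step z by (simp add: src_unit)
    then show ?case
      using step z unit_to_unit_to[of j "Suc j" n z] by simp
  qed simp
  then show ?thesis using a k src_to_cell by blast
qed

text \<open>
  Proper factors of \<open>x\<close> are smaller in the lexicographic order of the lengths of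
  \<open>x, s\<^sub>n\<^sub>-\<^sub>1(x), \<dots>, s\<^sub>0(x)\<close>: for a composite along dimension \<open>k\<close>, the lengths add up in the entries of
  dimension above \<open>k\<close>, and those of the other factor do not all vanish unless it is a unit on a
  \<open>k\<close>-cell.
\<close>

lemma indecomposables_generate:
  assumes C: "omega_category C" and b: "\<And>i. is_basis C i (E i)"
  shows "cells C n \<subseteq> generated C n {x. indecomposable C n x}"
proof
  interpret omega_category C by fact
  have "\<exists>l. additive_weight C i l \<and> (\<forall>e\<in>E i. l e = 1)" for i
    using basis_weight[OF C b, where w = "\<lambda>_. 1"] by metis
  then obtain l where l: "\<And>i. additive_weight C i (l i)" "\<And>i e. e \<in> E i \<Longrightarrow> l i e = 1"
    by metis
  \<comment> \<open>The index is reversed so that the top dimension is compared first.\<close>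
  define f where "f i x = l (n - i) (src_to C n (n - i) x)" for i x
  define R where "R = measures (map f [0..<Suc n])"
  have unit_if: "\<exists>z\<in>cells C j. y = unit C j z" if "y \<in> cells C (Suc j)" "l (Suc j) y = 0" for j y
    using weight_zero_imp_unit[OF C l(1) _ _ that(2), of "E (Suc j)"] l(2)
      basis_generates[OF b C, of "Suc j"] that by force
  have smaller: "(a, composite C n k a b) \<in> R" "(b, composite C n k a b) \<in> R"
    if c: "composable C n k a b" and nu: "a \<notin> unit_to C k n ` cells C k" "b \<notin> unit_to C k n ` cells C k"
    for k a b
  proof -
    have k: "k < n" and ab: "a \<in> cells C n" "b \<in> cells C n" using c by (auto simp: composable_def)
    \<comment> \<open>The first \<open>n - k\<close> entries belong to the dimensions above
      \<open>k\<close>, where lengths add up.\<close>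
    have "[0..<Suc n] = [0..<n - k] @ [n - k..<Suc n]"
      using upt_add_eq_append[of 0 "n - k" "Suc k"] k by simp
    then have R: "R = measures (map f [0..<n - k] @ map f [n - k..<Suc n])"
      by (simp add: R_def)
    have sum: "f i (composite C n k a b) = f i a + f i b" if "i < n - k" for i
      using src_to_comp_high[OF c, of "n - i"] l(1)[of "n - i"] that
      by (simp add: f_def additive_weight_def)
    have pos: "\<exists>i<n - k. 0 < f i x" if x: "x \<in> cells C n" "x \<notin> unit_to C k n ` cells C k" for x
    proof (rule ccontr)
      assume zero: "\<not> (\<exists>i<n - k. 0 < f i x)"
      have "\<exists>z\<in>cells C j. src_to C n (Suc j) x = unit C j z" if "k \<le> j" "j < n" for j
      proof (rule unit_if)
        show "src_to C n (Suc j) x \<in> cells C (Suc j)" using x that by (simp add: src_to_cell)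
        have "n - Suc j < n - k" "n - (n - Suc j) = Suc j" using that by auto
        then show "l (Suc j) (src_to C n (Suc j) x) = 0" using zero by (metis f_def gr0I)
      qed
      then show False using unit_to_if_faces_units[OF C x(1), of k] k x(2) by auto
    qed
    obtain i where i: "i < n - k" "0 < f i a" using pos[OF ab(1) nu(1)] by blast
    obtain i' where i': "i' < n - k" "0 < f i' b" using pos[OF ab(2) nu(2)] by blast
    \<comment> \<open>\<open>a\<close> is smaller because \<open>b\<close> contributes a positive
      length to some entry, and vice versa.\<close>
    show "(a, composite C n k a b) \<in> R"
      unfolding R by (rule in_measures_append) (use sum i' in \<open>auto intro!: bexI[of _ i']\<close>)
    show "(b, composite C n k a b) \<in> R"
      unfolding R by (rule in_measures_append) (use sum i in \<open>auto intro!: bexI[of _ i]\<close>)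
  qed
  have "wf R" by (simp add: R_def)
  fix x assume "x \<in> cells C n"
  then show "x \<in> generated C n {x. indecomposable C n x}"
  proof (induction x rule: wf_induct_rule[OF \<open>wf R\<close>])
    case (1 x)
    note less = 1
    show ?case
    proof (cases "indecomposable C n x")
      case True
      then show ?thesis by (simp add: generated.basis)
    next
      case False
      then consider m z where "n = Suc m" "z \<in> cells C m" "x = unit C m z"
        | k a b where "composable C n k a b" "x = composite C n k a b"
          "a \<notin> unit_to C k n ` cells C k" "b \<notin> unit_to C k n ` cells C k"
        using less(2) by (auto simp: indecomposable_def)
      then show ?thesis
      proof cases
        case 1
        then show ?thesis by (simp add: generated.unit)
      next
        case 2
        then show ?thesis using less(1)[of a] less(1)[of b] smaller[OF 2(1,3,4)]
          by (auto simp: composable_def intro!: generated.comp)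
      qed
    qed
  qed
qed

text \<open>An indecomposable composite equals one of its factors, so generation by
  \<open>E n\<close> puts indecomposables into \<open>E n\<close>. For the converse, a weight
  detects a basis element missing from them. Bases in all dimensions enter through the lengths of
  iterated sources.\<close>

lemma basis_eq_indecomposables:
  assumes C: "omega_category C" and b: "\<And>i. is_basis C i (E i)"
  shows "E n = {x. indecomposable C n x}"
proof
  interpret omega_category C by fact
  have E: "E n \<subseteq> cells C n" using b by (simp add: is_basis_def)
  have "indecomposable C n x \<longrightarrow> x \<in> E n" if "x \<in> generated C n (E n)" for x
    using that
  proof induction
    case (comp k x y)
    show ?case
    proof
      assume "indecomposable C n (composite C n k x y)"
      moreover from this have "x \<in> unit_to C k n ` cells C k \<or> y \<in> unit_to C k n ` cells C k"
        using comp(1) unfolding indecomposable_def by blast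
      ultimately show "composite C n k x y \<in> E n"
        using comp comp_unit_to_left comp_unit_to_right by metis
    qed
  qed (auto simp: indecomposable_def)
  then show sub: "{x. indecomposable C n x} \<subseteq> E n"
    using basis_generates[OF b C, of n] by (auto simp: indecomposable_def)
  show "E n \<subseteq> {x. indecomposable C n x}"
  proof
    fix e assume e: "e \<in> E n"
    \<comment> \<open>The weight is 1 at \<open>e\<close> and 0 on the rest of the basis. If
      \<open>e\<close> were not indecomposable, it would vanish on all indecomposables and hence on
      \<open>e\<close>, which they generate.\<close>
    obtain l where l: "additive_weight C n l" "\<And>e'. e' \<in> E n \<Longrightarrow> l e' = (if e' = e then 1 else 0)"
      using basis_weight[OF C b, where w = "\<lambda>e'. if e' = e then 1 else 0"] by metis
    show "e \<in> {x. indecomposable C n x}"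
    proof (rule ccontr)
      assume ne: "e \<notin> {x. indecomposable C n x}"
      have "l x = 0" if "x \<in> generated C n {x. indecomposable C n x}" for x
        using that
      proof induction
        case (basis x)
        then show ?case using l(2)[of x] sub ne by auto
      qed (use l(1) in \<open>auto simp: additive_weight_def\<close>)
      then show False
        using indecomposables_generate[OF C b, of n] e E l(2)[OF e] by fastforce
    qed
  qed
qed

section \<open>Bases and discrete Conduche functors\<close>

locale conduche = omega_functor C D F for C :: "'c ocat" and D :: "'d ocat" and F +
  assumes dc: "discrete_conduche C D F"
begin

section \<open>Lifting of units and decompositions\<close>

lemma unit_to_lift:
  assumes "x \<in> cells C n" "y \<in> cells D k" "k \<le> n" "F n x = unit_to D k n y"
  obtains z where "z \<in> cells C k" "x = unit_to C k n z" "F k z = y"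
proof (cases "k = n")
  case True
  then show thesis using that assms by simp
next
  case False
  then have "\<exists>!z. z \<in> cells C k \<and> x = unit_to C k n z \<and> F k z = y"
    using dc assms by (simp add: discrete_conduche_def)
  then show thesis using that by blast
qed

lemma unit_lift:
  assumes "x \<in> cells C (Suc m)" "y \<in> cells D m" "F (Suc m) x = unit D m y"
  obtains z where "z \<in> cells C m" "x = unit C m z" "F m z = y"
  using unit_to_lift[of x "Suc m" y m] assms by auto

lemma comp_lift_ex1:
  assumes "x \<in> cells C n" "composable D n k y' y''" "F n x = composite D n k y' y''"
  shows "\<exists>!(x', x''). composable C n k x' x'' \<and> x = composite C n k x' x'' \<and>
              F n x' = y' \<and> F n x'' = y''"
proof -
  have "k < n" using assms by (simp add: composable_def)
  then show ?thesis using dc assms by (simp add: discrete_conduche_def)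
qed

lemma comp_lift:
  assumes "x \<in> cells C n" "composable D n k y' y''" "F n x = composite D n k y' y''"
  obtains a b where "composable C n k a b" "x = composite C n k a b" "F n a = y'" "F n b = y''"
  using comp_lift_ex1[OF assms] by auto

lemma unit_to_image_iff:
  assumes "x \<in> cells C n" "k \<le> n"
  shows "F n x \<in> unit_to D k n ` cells D k \<longleftrightarrow> x \<in> unit_to C k n ` cells C k"
proof
  assume "F n x \<in> unit_to D k n ` cells D k"
  then obtain y where "y \<in> cells D k" "F n x = unit_to D k n y" by blast
  then obtain z where "z \<in> cells C k" "x = unit_to C k n z"
    using unit_to_lift[of x n y k] assms by blast
  then show "x \<in> unit_to C k n ` cells C k" by blast
next
  assume "x \<in> unit_to C k n ` cells C k"
  then obtain z where "z \<in> cells C k" "x = unit_to C k n z" by blast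
  then show "F n x \<in> unit_to D k n ` cells D k" using map_unit_to[of z k n] map_cell assms by blast
qed

text \<open>Factorisations are mapped forward by \<open>F\<close> and lifted back by the Conduche
  property; by \<open>unit_to_image_iff\<close> a factor is trivial in \<open>C\<close> exactly when
  its image is trivial in \<open>D\<close>.\<close>

lemma indecomposable_iff:
  assumes x: "x \<in> cells C n"
  shows "indecomposable D n (F n x) \<longleftrightarrow> indecomposable C n x"
proof
  assume i: "indecomposable D n (F n x)"
  have "x \<noteq> unit C m z" if "n = Suc m" "z \<in> cells C m" for m z
    using i that map_cell[of z m] by (auto simp: indecomposable_def map_unit)
  moreover have "a \<in> unit_to C k n ` cells C k \<or> b \<in> unit_to C k n ` cells C k"
    if "composable C n k a b" "x = composite C n k a b" for k a b
  proof -
    have "a \<in> cells C n" "b \<in> cells C n" "k \<le> n" using that by (auto simp: composable_def)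
    moreover have "F n a \<in> unit_to D k n ` cells D k \<or> F n b \<in> unit_to D k n ` cells D k"
      using i that map_comp[OF that(1)] map_composable[OF that(1)] by (simp add: indecomposable_def)
    ultimately show ?thesis by (simp add: unit_to_image_iff)
  qed
  ultimately show "indecomposable C n x" using x by (simp add: indecomposable_def)
next
  assume i: "indecomposable C n x"
  have "F n x \<noteq> unit D m z" if "n = Suc m" "z \<in> cells D m" for m z
    using i that unit_lift[of x m z] x by (auto simp: indecomposable_def)
  moreover have "a \<in> unit_to D k n ` cells D k \<or> b \<in> unit_to D k n ` cells D k"
    if c: "composable D n k a b" "F n x = composite D n k a b" for k a b
  proof -
    obtain a' b' where ab: "composable C n k a' b'" "x = composite C n k a' b'" "F n a' = a" "F n b' = b"
      using comp_lift[OF x c] .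
    have "a' \<in> cells C n" "b' \<in> cells C n" "k \<le> n" using ab by (auto simp: composable_def)
    moreover have "a' \<in> unit_to C k n ` cells C k \<or> b' \<in> unit_to C k n ` cells C k"
      using i ab by (simp add: indecomposable_def)
    ultimately show ?thesis using unit_to_image_iff ab by blast
  qed
  ultimately show "indecomposable D n (F n x)" using x by (simp add: indecomposable_def map_cell)
qed

section \<open>Generation and bases along \<open>F\<close>\<close>

text \<open>Every step in the generation of \<open>d\<close> lifts to any cell over
  \<open>d\<close>, so the induction treats all these cells \<open>x\<close> at once.\<close>

lemma generated_vimage:
  assumes "d \<in> generated D n E" "x \<in> cells C n" "F n x = d"
  shows "x \<in> generated C n {x \<in> cells C n. F n x \<in> E}"
  using assms
proof (induction arbitrary: x)
  case (unit m z)
  then obtain z' where "z' \<in> cells C m" "x = unit C m z'" using unit_lift[of x m z] by blast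
  then show ?case using generated.unit[OF unit.hyps(1)] by simp
next
  case (basis e)
  then show ?case by (auto intro: generated.basis)
next
  case (comp k a b)
  obtain a' b' where ab: "composable C n k a' b'" "x = composite C n k a' b'" "F n a' = a" "F n b' = b"
    using comp_lift[OF comp.prems(1) comp.hyps(1) comp.prems(2)] .
  then have "a' \<in> cells C n" "b' \<in> cells C n" by (auto simp: composable_def)
  then show ?case
    using generated.comp[OF ab(1) comp.IH(1)[OF _ ab(3)] comp.IH(2)[OF _ ab(4)]] ab(2) by simp
qed

lemma generated_image:
  assumes "x \<in> generated C n {x \<in> cells C n. F n x \<in> E}"
  shows "F n x \<in> generated D n E"
  using assms
proof induction
  case (unit m z)
  then show ?case using generated.unit[of n m "F m z" D E] by (simp add: map_unit map_cell)
next
  case (comp k a b)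
  then show ?case using generated.comp[OF map_composable[OF comp(1)]] by (simp add: map_comp)
next
  case (basis x)
  then show ?case by (simp add: generated.basis)
qed

text \<open>The extension is first made over \<open>C\<close>, where below dimension
  \<open>n\<close> it is \<open>p\<close> composed with \<open>F\<close>. Being constant on the
  fibres, it descends along the surjections.\<close>

lemma basis_image:
  assumes surj: "\<And>m. F m ` cells C m = cells D m" and E: "E \<subseteq> cells D n"
    and b: "is_basis C n {x \<in> cells C n. F n x \<in> E}"
  shows "is_basis D n E"
proof (rule is_basisI[OF cod.omega_category_axioms E])
  let ?B = "{x \<in> cells C n. F n x \<in> E}"
  have gen: "cells C n \<subseteq> generated C n ?B"
    by (rule basis_generates[OF b dom.omega_category_axioms])
  show "cells D n \<subseteq> generated D n E"
  proof
    fix y assume "y \<in> cells D n"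
    then obtain x where "x \<in> cells C n" "y = F n x" using surj[of n] by blast
    then show "y \<in> generated D n E" using generated_image[of x n E] gen by auto
  qed
  fix T :: "(nat + 'd + 'd \<times> nat \<times> bool + 'd) list ocat" and p q
  assume p: "functor_below D T n p" and q: "\<And>e. e \<in> E \<Longrightarrow> q e \<in> cells T n"
    and q_src: "\<And>e m. e \<in> E \<Longrightarrow> n = Suc m \<Longrightarrow> src T m (q e) = p m (src D m e)"
    and q_tgt: "\<And>e m. e \<in> E \<Longrightarrow> n = Suc m \<Longrightarrow> tgt T m (q e) = p m (tgt D m e)"
  interpret p: functor_below D T n p by fact
  have pF: "functor_below C T n (\<lambda>m x. p m (F m x))"
    by unfold_locales
      (simp_all add: map_cell p.map_cell map_src p.map_src map_tgt p.map_tgt map_unit p.map_unit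
        map_comp p.map_comp map_composable)
  obtain h where h: "functor_below C T (Suc n) h"
    "\<And>m x. m < n \<Longrightarrow> x \<in> cells C m \<Longrightarrow> h m x = p m (F m x)" "\<And>e. e \<in> ?B \<Longrightarrow> h n e = q (F n e)"
    by (rule basis_extension[OF b pF, of "\<lambda>x. q (F n x)"])
      (use q q_src q_tgt in \<open>auto simp: map_src map_tgt\<close>)
  interpret h: functor_below C T "Suc n" h by fact
  \<comment> \<open>The cell \<open>x'\<close> varies in the induction: a decomposition of
    \<open>x\<close> is mapped to \<open>D\<close> and lifted to \<open>x'\<close>, so that the
    factors of both have equal images.\<close>
  have top: "\<forall>x'\<in>cells C n. F n x' = F n x \<longrightarrow> h n x' = h n x" if "x \<in> generated C n ?B" for x
    using that
  proof induction
    case (unit m z)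
    show ?case
    proof (intro ballI impI)
      fix x' assume "x' \<in> cells C n" "F n x' = F n (unit C m z)"
      then obtain z' where "z' \<in> cells C m" "x' = unit C m z'" "F m z' = F m z"
        using unit_lift[of x' m "F m z"] unit by (auto simp: map_unit map_cell)
      then show "h n x' = h n (unit C m z)"
        using unit h.map_unit[of _ m] h(2)[of m] by simp
    qed
  next
    case (basis e)
    then show ?case using h(3) by simp
  next
    case (comp k a b)
    show ?case
    proof (intro ballI impI)
      fix x' assume x': "x' \<in> cells C n" "F n x' = F n (composite C n k a b)"
      obtain a' b' where ab: "composable C n k a' b'" "x' = composite C n k a' b'"
        "F n a' = F n a" "F n b' = F n b"
        using comp_lift[OF x'(1) map_composable[OF comp.hyps(1)]] x'(2) map_comp[OF comp.hyps(1)]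
        by metis
      then have "h n a' = h n a" "h n b' = h n b" using comp.IH by (auto simp: composable_def)
      then show "h n x' = h n (composite C n k a b)"
        using ab h.map_comp[OF ab(1)] h.map_comp[OF comp.hyps(1)] by simp
    qed
  qed
  \<comment> \<open>Independent of the chosen preimage: by \<open>h(2)\<close> below dimension
    \<open>n\<close>, by \<open>top\<close> in dimension \<open>n\<close>.\<close>
  define g where "g m y = h m (inv_into (cells C m) (F m) y)" for m y
  have g: "g m (F m x) = h m x" if "m < Suc n" "x \<in> cells C m" for m x
  proof -
    let ?x = "inv_into (cells C m) (F m) (F m x)"
    have "?x \<in> cells C m" "F m ?x = F m x"
      using that by (auto intro: inv_into_into f_inv_into_f)
    then show ?thesis using that h(2) top[of x] gen by (cases "m = n") (auto simp: g_def)
  qed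
  have lift: "\<exists>x\<in>cells C m. y = F m x" if "y \<in> cells D m" for m y
    using that surj[of m] by blast
  have gT: "functor_below D T (Suc n) g"
  proof (unfold_locales, goal_cases)
    case (1 y m)
    then show ?case using lift[of y m] g h.map_cell by fastforce
  next
    case (2 y m)
    then obtain x where "x \<in> cells C (Suc m)" "y = F (Suc m) x" using lift by blast
    then show ?case using 2 g[of m "src C m x"] g[of "Suc m" x] h.map_src[of x m]
      by (simp add: map_src dom.src_cell)
  next
    case (3 y m)
    then obtain x where "x \<in> cells C (Suc m)" "y = F (Suc m) x" using lift by blast
    then show ?case using 3 g[of m "tgt C m x"] g[of "Suc m" x] h.map_tgt[of x m]
      by (simp add: map_tgt dom.tgt_cell)
  next
    case (4 y m)
    then obtain x where "x \<in> cells C m" "y = F m x" using lift by blast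
    then show ?case using 4 g[of m x] g[of "Suc m" "unit C m x"] h.map_unit[of x m]
      by (simp add: map_unit dom.unit_cell)
  next
    case (5 m k y y')
    \<comment> \<open>Arbitrary preimages of \<open>y\<close> and \<open>y'\<close> might not be
      composable; a composable pair is found by lifting their composite.\<close>
    obtain x where x: "x \<in> cells C m" "composite D m k y y' = F m x"
      using lift cod.comp_cell[OF 5(1)] by blast
    obtain a b where ab: "composable C m k a b" "x = composite C m k a b" "F m a = y" "F m b = y'"
      using comp_lift[OF x(1) 5(1)] x(2) by metis
    then have "a \<in> cells C m" "b \<in> cells C m" by (auto simp: composable_def)
    then show ?case using 5 x ab g[of m] h.map_comp[OF ab(1)] by metis
  qed
  have "g m y = p m y" if "m < n" "y \<in> cells D m" for m y
    using lift[OF that(2)] that g[of m] h(2) by auto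
  moreover have "g n e = q e" if e: "e \<in> E" for e
  proof -
    obtain x where "x \<in> cells C n" "e = F n x" using lift e E by blast
    then show ?thesis using e g[of n x] h(3)[of x] by simp
  qed
  ultimately show "\<exists>h. functor_below D T (Suc n) h \<and> (\<forall>m<n. \<forall>x\<in>cells D m. h m x = p m x) \<and>
      (\<forall>e\<in>E. h n e = q e)"
    using gT by blast
qed

end

section \<open>The omega-category of sections\<close>

context omega_category
begin

lemma src_to_eq_of_composable:
  assumes "composable C n k x y" "j < k"
  shows "src_to C n j x = src_to C n j y"
  using assms src_to_src_to[of j k n x] src_to_tgt_to[of y n j k] by (simp add: composable_def)

lemma tgt_to_eq_of_composable:
  assumes "composable C n k x y" "j < k"
  shows "tgt_to C n j x = tgt_to C n j y"
  using assms tgt_to_tgt_to[of j k n y] tgt_to_src_to[of x n j k] by (simp add: composable_def)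

lemma composable_comp_left_iff:
  assumes "composable C n k x y"
  shows "composable C n k (composite C n k x y) z \<longleftrightarrow> composable C n k y z"
  using assms src_to_comp_low[OF assms, of k] comp_cell[OF assms] by (simp add: composable_def)

lemma composable_comp_right_iff:
  assumes "composable C n k y z"
  shows "composable C n k x (composite C n k y z) \<longleftrightarrow> composable C n k x y"
  using assms tgt_to_comp_low[OF assms, of k] comp_cell[OF assms] by (simp add: composable_def)

text \<open>For \<open>l < k\<close>, \<open>k\<close>-composable cells have the same
  \<open>l\<close>-faces, so all these conditions compare the same two
  \<open>l\<close>-cells.\<close>

lemma exchange_composable_iff:
  assumes "l < k" and xx': "composable C n k x x'" and yy': "composable C n k y y'"
  shows "composable C n l (composite C n k x x') (composite C n k y y') \<longleftrightarrow> composable C n l x y"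
    and "composable C n l x' y' \<longleftrightarrow> composable C n l x y"
  using assms src_to_comp_low[OF xx', of l] tgt_to_comp_low[OF yy', of l]
    src_to_eq_of_composable[OF xx', of l] tgt_to_eq_of_composable[OF yy', of l]
    comp_cell[OF xx'] comp_cell[OF yy']
  by (auto simp: composable_def)

lemma exchange_composable:
  assumes "l < k" and xx': "composable C n k x x'" and yy': "composable C n k y y'"
    and xy: "composable C n l x y"
  shows "composable C n k (composite C n l x y) (composite C n l x' y')"
proof -
  have xy': "composable C n l x' y'" using exchange_composable_iff(2)[OF assms(1-3)] xy by simp
  have "k < n" "src_to C n k x = tgt_to C n k x'" "src_to C n k y = tgt_to C n k y'"
    using xx' yy' by (simp_all add: composable_def)
  then show ?thesis
    using src_to_comp_high[OF xy, of k] tgt_to_comp_high[OF xy', of k] assms(1)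
      comp_cell[OF xy] comp_cell[OF xy'] by (simp add: composable_def)
qed

lemma skel_src_to_eq_tgt_to:
  assumes "x \<in> cells (skel (Suc n) C) m" "n \<le> m"
  shows "tgt_to C m n x = src_to C m n x"
proof -
  obtain z where "z \<in> cells C n" "x = unit_to C n m z"
    using skel_top[of x "Suc n" m] assms by auto
  then show ?thesis using assms by (simp add: src_to_unit_to tgt_to_unit_to)
qed

end

section \<open>Sections over \<open>n\<close>-cells of \<open>D\<close>, their units and
  composites\<close>

locale conduche_sections = conduche C D F + p: functor_below C T n p
  for C :: "'c ocat" and D :: "'d ocat" and F and T :: "'t ocat" and n p
begin

definition fibre :: "'d \<Rightarrow> 'c set" where
  "fibre d = {x \<in> cells C n. F n x = d}"

text \<open>A section over \<open>d\<close> records candidate values of an extension of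
  \<open>p\<close> at all cells over \<open>d\<close>. Fixing the value outside the fibre makes
  sections equal as soon as they agree on it.\<close>

definition is_section :: "'d \<Rightarrow> ('c \<Rightarrow> 't) \<Rightarrow> bool" where
  "is_section d \<sigma> \<longleftrightarrow> (\<forall>x. x \<notin> fibre d \<longrightarrow> \<sigma> x = undefined) \<and>
     (\<forall>x\<in>fibre d. \<sigma> x \<in> cells T n \<and>
        (\<forall>j<n. src_to T n j (\<sigma> x) = p j (src_to C n j x) \<and>
               tgt_to T n j (\<sigma> x) = p j (tgt_to C n j x)))"

text \<open>Meaningful for \<open>n > 0\<close> and \<open>d\<close> a unit: cells over a unit are
  units by the Conduche property, so their values are forced by \<open>p\<close>, and the source
  recovers the underlying cell.\<close>

definition unit_section :: "'d \<Rightarrow> 'c \<Rightarrow> 't" where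
  "unit_section d x =
     (if x \<in> fibre d then unit T (n - 1) (p (n - 1) (src C (n - 1) x)) else undefined)"

text \<open>The two sections are evaluated at the factors of \<open>x\<close> over \<open>d\<close>
  and \<open>d'\<close>. These exist uniquely by the Conduche property, which justifies the definite
  description.\<close>

definition comp_section :: "nat \<Rightarrow> 'd \<Rightarrow> ('c \<Rightarrow> 't) \<Rightarrow> 'd \<Rightarrow> ('c \<Rightarrow> 't) \<Rightarrow> 'c \<Rightarrow> 't" where
  "comp_section k d \<sigma> d' \<sigma>' x =
     (if x \<in> fibre (composite D n k d d')
      then case THE (a, b). composable C n k a b \<and> x = composite C n k a b \<and> F n a = d \<and> F n b = d'
           of (a, b) \<Rightarrow> composite T n k (\<sigma> a) (\<sigma>' b)
      else undefined)"

lemma section_eqI: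
  assumes "is_section d \<sigma>" "is_section d \<sigma>'" "\<And>x. x \<in> fibre d \<Longrightarrow> \<sigma> x = \<sigma>' x"
  shows "\<sigma> = \<sigma>'"
  using assms by (intro ext) (metis is_section_def)

lemma comp_section_apply:
  assumes c: "composable C n k a b" and "F n a = d" "F n b = d'"
  shows "comp_section k d \<sigma> d' \<sigma>' (composite C n k a b) = composite T n k (\<sigma> a) (\<sigma>' b)"
proof -
  let ?P = "\<lambda>(a', b'). composable C n k a' b' \<and> composite C n k a b = composite C n k a' b' \<and>
    F n a' = d \<and> F n b' = d'"
  have "composite C n k a b \<in> fibre (composite D n k d d')"
    using assms dom.comp_cell[OF c] map_comp[OF c] by (simp add: fibre_def)
  moreover have "\<exists>!ab. ?P ab"
    using comp_lift_ex1[OF dom.comp_cell[OF c] map_composable[OF c] map_comp[OF c]] assms(2,3) by simp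
  then have "(THE ab. ?P ab) = (a, b)" by (rule the1_equality) (use assms in simp)
  ultimately show ?thesis by (simp add: comp_section_def)
qed

text \<open>As \<open>k < n\<close>, the \<open>k\<close>-faces of both values are prescribed by
  \<open>p\<close>, and they agree because \<open>a\<close> and \<open>b\<close> are
  composable.\<close>

lemma section_composable:
  assumes c: "composable C n k a b" and \<sigma>: "is_section (F n a) \<sigma>" "is_section (F n b) \<sigma>'"
  shows "composable T n k (\<sigma> a) (\<sigma>' b)"
proof -
  have "a \<in> fibre (F n a)" "b \<in> fibre (F n b)" "k < n" "src_to C n k a = tgt_to C n k b"
    using c by (simp_all add: composable_def fibre_def)
  then show ?thesis using \<sigma> by (simp add: composable_def is_section_def)
qed

lemma fibre_comp_cases:
  assumes "x \<in> fibre (composite D n k d d')" and "composable D n k d d'"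
  obtains a b where "composable C n k a b" "x = composite C n k a b" "F n a = d" "F n b = d'"
    "a \<in> fibre d" "b \<in> fibre d'"
proof -
  obtain a b where "composable C n k a b" "x = composite C n k a b" "F n a = d" "F n b = d'"
    using comp_lift[of x n k d d'] assms by (auto simp: fibre_def)
  then show thesis using that[of a b] by (simp add: composable_def fibre_def)
qed

text \<open>Faces of dimension at most \<open>k\<close> come from one factor; those strictly between
  \<open>k\<close> and \<open>n\<close> are composites, which \<open>p\<close> preserves.\<close>

lemma is_section_comp:
  assumes c: "composable D n k d d'" and \<sigma>: "is_section d \<sigma>" "is_section d' \<sigma>'"
  shows "is_section (composite D n k d d') (comp_section k d \<sigma> d' \<sigma>')"
  unfolding is_section_def
proof (intro conjI allI impI ballI)
  show "comp_section k d \<sigma> d' \<sigma>' x = undefined" if "x \<notin> fibre (composite D n k d d')" for x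
    using that by (simp add: comp_section_def)
  fix x assume "x \<in> fibre (composite D n k d d')"
  then obtain a b where ab: "composable C n k a b" "x = composite C n k a b" "F n a = d" "F n b = d'"
    "a \<in> fibre d" "b \<in> fibre d'"
    using c by (rule fibre_comp_cases)
  have cT: "composable T n k (\<sigma> a) (\<sigma>' b)" using section_composable[OF ab(1)] ab \<sigma> by simp
  have x: "comp_section k d \<sigma> d' \<sigma>' x = composite T n k (\<sigma> a) (\<sigma>' b)"
    using comp_section_apply ab by simp
  show "comp_section k d \<sigma> d' \<sigma>' x \<in> cells T n" unfolding x by (rule p.cod.comp_cell[OF cT])
  fix j assume j: "j < n"
  have st: "src_to T n j (\<sigma> a) = p j (src_to C n j a)" "src_to T n j (\<sigma>' b) = p j (src_to C n j b)"
    "tgt_to T n j (\<sigma> a) = p j (tgt_to C n j a)" "tgt_to T n j (\<sigma>' b) = p j (tgt_to C n j b)"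
    using \<sigma> ab j by (simp_all add: is_section_def)
  show "src_to T n j (comp_section k d \<sigma> d' \<sigma>' x) = p j (src_to C n j x)"
  proof (cases "j \<le> k")
    case True
    then show ?thesis unfolding x
      using ab(2) p.cod.src_to_comp_low[OF cT] dom.src_to_comp_low[OF ab(1)] st by simp
  next
    case False
    then show ?thesis unfolding x
      using ab(2) p.cod.src_to_comp_high[OF cT, of j] dom.src_to_comp_high[OF ab(1), of j] st j p.map_comp
      by simp
  qed
  show "tgt_to T n j (comp_section k d \<sigma> d' \<sigma>' x) = p j (tgt_to C n j x)"
  proof (cases "j \<le> k")
    case True
    then show ?thesis unfolding x
      using ab(2) p.cod.tgt_to_comp_low[OF cT] dom.tgt_to_comp_low[OF ab(1)] st by simp
  next
    case False
    then show ?thesis unfolding x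
      using ab(2) p.cod.tgt_to_comp_high[OF cT, of j] dom.tgt_to_comp_high[OF ab(1), of j] st j p.map_comp
      by simp
  qed
qed

text \<open>Both sides evaluate at the same three factors of \<open>x\<close>: lifting one
  bracketing and reassociating in \<open>C\<close> lifts the other as well. The claim then becomes
  associativity in \<open>T\<close>.\<close>

lemma comp_section_assoc:
  assumes c: "composable D n k d d'" "composable D n k d' d''"
    and \<sigma>: "is_section d \<sigma>" "is_section d' \<sigma>'" "is_section d'' \<sigma>''"
  shows "comp_section k (composite D n k d d') (comp_section k d \<sigma> d' \<sigma>') d'' \<sigma>'' =
    comp_section k d \<sigma> (composite D n k d' d'') (comp_section k d' \<sigma>' d'' \<sigma>'')"
    (is "?l = ?r")
proof (rule section_eqI)
  have c': "composable D n k (composite D n k d d') d''" "composable D n k d (composite D n k d' d'')"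
    using c by (simp_all add: cod.composable_comp_left_iff cod.composable_comp_right_iff)
  show "is_section (composite D n k (composite D n k d d') d'') ?l"
    by (intro is_section_comp c' c \<sigma>)
  show "is_section (composite D n k (composite D n k d d') d'') ?r"
    unfolding cod.assoc[OF c] by (intro is_section_comp c' c \<sigma>)
  fix x assume "x \<in> fibre (composite D n k (composite D n k d d') d'')"
  then obtain u v where uv: "composable C n k u v" "x = composite C n k u v"
    "F n u = composite D n k d d'" "F n v = d''" "u \<in> fibre (composite D n k d d')" "v \<in> fibre d''"
    using c'(1) by (rule fibre_comp_cases)
  obtain a b where ab: "composable C n k a b" "u = composite C n k a b"
    "F n a = d" "F n b = d'" "a \<in> fibre d" "b \<in> fibre d'"
    using uv(5) c(1) by (rule fibre_comp_cases)
  have bv: "composable C n k b v" using uv(1) ab by (simp add: dom.composable_comp_left_iff)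
  have abv: "composable C n k a (composite C n k b v)"
    using ab bv by (simp add: dom.composable_comp_right_iff)
  have "?l x = composite T n k (composite T n k (\<sigma> a) (\<sigma>' b)) (\<sigma>'' v)"
    using comp_section_apply[OF uv(1,3,4)] comp_section_apply[OF ab(1,3,4)] uv(2) ab(2) by simp
  also have "\<dots> = composite T n k (\<sigma> a) (composite T n k (\<sigma>' b) (\<sigma>'' v))"
    using section_composable ab bv uv \<sigma> by (intro p.cod.assoc) auto
  also have "\<dots> = ?r (composite C n k a (composite C n k b v))"
    using comp_section_apply[OF abv ab(3)] comp_section_apply[OF bv ab(4) uv(4)] map_comp[OF bv] ab uv
    by simp
  finally show "?l x = ?r x" using dom.assoc[OF ab(1) bv] uv ab by simp
qed

text \<open>As for associativity: \<open>x\<close> decomposes into four cells lying over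
  \<open>d\<close>, \<open>d'\<close>, \<open>e\<close>, \<open>e'\<close>, and the exchange laws of
  \<open>C\<close> and \<open>T\<close> match the two evaluations.\<close>

lemma comp_section_exchange:
  assumes lk: "l < k" and c: "composable D n k d d'" "composable D n k e e'"
    "composable D n l d e" "composable D n l d' e'"
    and \<sigma>: "is_section d \<sigma>" "is_section d' \<sigma>'" "is_section e \<tau>" "is_section e' \<tau>'"
  shows "comp_section l (composite D n k d d') (comp_section k d \<sigma> d' \<sigma>')
      (composite D n k e e') (comp_section k e \<tau> e' \<tau>') =
    comp_section k (composite D n l d e) (comp_section l d \<sigma> e \<tau>)
      (composite D n l d' e') (comp_section l d' \<sigma>' e' \<tau>')"
    (is "?l = ?r")
proof (rule section_eqI)
  have c': "composable D n l (composite D n k d d') (composite D n k e e')"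
    "composable D n k (composite D n l d e) (composite D n l d' e')"
    using cod.exchange_composable_iff(1)[OF lk c(1,2)] c cod.exchange_composable[OF lk c(1-3)]
    by simp_all
  show "is_section (composite D n l (composite D n k d d') (composite D n k e e')) ?l"
    by (intro is_section_comp c' c \<sigma>)
  show "is_section (composite D n l (composite D n k d d') (composite D n k e e')) ?r"
    unfolding cod.exchange[OF lk c] by (intro is_section_comp c' c \<sigma>)
  fix x assume "x \<in> fibre (composite D n l (composite D n k d d') (composite D n k e e'))"
  then obtain u v where uv: "composable C n l u v" "x = composite C n l u v"
    "F n u = composite D n k d d'" "F n v = composite D n k e e'"
    "u \<in> fibre (composite D n k d d')" "v \<in> fibre (composite D n k e e')"
    using c'(1) by (rule fibre_comp_cases)
  obtain a a' where a: "composable C n k a a'" "u = composite C n k a a'"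
    "F n a = d" "F n a' = d'" "a \<in> fibre d" "a' \<in> fibre d'"
    using uv(5) c(1) by (rule fibre_comp_cases)
  obtain b b' where b: "composable C n k b b'" "v = composite C n k b b'"
    "F n b = e" "F n b' = e'" "b \<in> fibre e" "b' \<in> fibre e'"
    using uv(6) c(2) by (rule fibre_comp_cases)
  have ab: "composable C n l a b" "composable C n l a' b'"
    using dom.exchange_composable_iff[OF lk a(1) b(1)] uv a b by simp_all
  have ab': "composable C n k (composite C n l a b) (composite C n l a' b')"
    by (rule dom.exchange_composable[OF lk a(1) b(1) ab(1)])
  have "?l x = composite T n l (composite T n k (\<sigma> a) (\<sigma>' a')) (composite T n k (\<tau> b) (\<tau>' b'))"
    using comp_section_apply[OF uv(1,3,4)] comp_section_apply[OF a(1,3,4)]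
      comp_section_apply[OF b(1,3,4)] uv(2) a(2) b(2) by simp
  also have "\<dots> = composite T n k (composite T n l (\<sigma> a) (\<tau> b)) (composite T n l (\<sigma>' a') (\<tau>' b'))"
    using section_composable a b ab \<sigma> by (intro p.cod.exchange[OF lk]) auto
  also have "\<dots> = ?r (composite C n k (composite C n l a b) (composite C n l a' b'))"
    using comp_section_apply[OF ab'] comp_section_apply[OF ab(1) a(3) b(3)]
      comp_section_apply[OF ab(2) a(4) b(4)] map_comp[OF ab(1)] map_comp[OF ab(2)] a b by simp
  finally show "?l x = ?r x" using dom.exchange[OF lk a(1) b(1) ab] uv a b by simp
qed

lemma unit_section_apply:
  assumes "n = Suc m" "z \<in> cells C m"
  shows "unit_section (unit D m (F m z)) (unit C m z) = unit T m (p m z)"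
  unfolding unit_section_def fibre_def
  using assms by (simp add: dom.unit_cell map_unit dom.src_unit)

lemma unit_section_apply_to:
  assumes k: "k < n" and z: "z \<in> cells C k"
  shows "unit_section (unit_to D k n (F k z)) (unit_to C k n z) = unit_to T k n (p k z)"
proof -
  obtain m where m: "n = Suc m" "k \<le> m" using k by (cases n) auto
  then show ?thesis
    using unit_section_apply[OF m(1) dom.unit_to_cell[OF z m(2)]] z
    by (simp add: map_unit_to p.map_unit_to)
qed

lemma is_section_unit:
  assumes m: "n = Suc m" and d: "d \<in> cells D m"
  shows "is_section (unit D m d) (unit_section (unit D m d))"
  unfolding is_section_def
proof (intro conjI allI impI ballI)
  show "unit_section (unit D m d) x = undefined" if "x \<notin> fibre (unit D m d)" for x
    using that by (simp add: unit_section_def)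
  fix x assume "x \<in> fibre (unit D m d)"
  then have "x \<in> cells C n" "F n x = unit D m d" by (simp_all add: fibre_def)
  then obtain z where z: "z \<in> cells C m" "x = unit C m z" "d = F m z"
    using unit_lift[of x m d] d m by auto
  have x: "unit_section (unit D m d) x = unit T m (p m z)"
    using unit_section_apply[OF m z(1)] z by simp
  have pz: "p m z \<in> cells T m" using p.map_cell[OF z(1)] m by simp
  show "unit_section (unit D m d) x \<in> cells T n"
    unfolding x using p.cod.unit_cell[OF pz] m by simp
  fix j assume j: "j < n"
  then have "j \<le> m" using m by simp
  then show "src_to T n j (unit_section (unit D m d) x) = p j (src_to C n j x)"
    "tgt_to T n j (unit_section (unit D m d) x) = p j (tgt_to C n j x)"
    unfolding x
    using z pz p.map_src_to[of z m j] p.map_tgt_to[of z m j] m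
    by (simp_all add: p.cod.src_unit p.cod.tgt_unit dom.src_unit dom.tgt_unit)
qed

lemma is_section_unit_to:
  assumes "k < n" and "d \<in> cells D k"
  shows "is_section (unit_to D k n d) (unit_section (unit_to D k n d))"
proof -
  obtain m where "n = Suc m" "k \<le> m" using assms(1) by (cases n) auto
  then show ?thesis using is_section_unit[of m "unit_to D k m d"] assms by (simp add: cod.unit_to_cell)
qed

text \<open>The lifted left factor of \<open>x\<close> is the iterated unit on its
  \<open>k\<close>-target, where the unit section takes the corresponding unit of \<open>T\<close>
  as value.\<close>

lemma comp_section_unit_left:
  assumes k: "k < n" and d: "d \<in> cells D n" and \<sigma>: "is_section d \<sigma>"
  defines "u \<equiv> unit_to D k n (tgt_to D n k d)"
  shows "comp_section k u (unit_section u) d \<sigma> = \<sigma>"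
proof (rule section_eqI[OF _ \<sigma>])
  have t: "tgt_to D n k d \<in> cells D k" using d k by (simp add: cod.tgt_to_cell)
  have c: "composable D n k u d"
    using t d k by (simp add: u_def composable_def cod.src_to_unit_to cod.unit_to_cell)
  have e: "composite D n k u d = d" unfolding u_def by (rule cod.unit_left[OF d k])
  show "is_section d (comp_section k u (unit_section u) d \<sigma>)"
    using is_section_comp[OF c _ \<sigma>, of "unit_section u"] is_section_unit_to[OF k t] e
    by (simp add: u_def)
  fix x assume x: "x \<in> fibre d"
  then have xC: "x \<in> cells C n" "F n x = d" by (simp_all add: fibre_def)
  let ?z = "tgt_to C n k x"
  have z: "?z \<in> cells C k" using xC k by (simp add: dom.tgt_to_cell)
  have Fz: "F k ?z = tgt_to D n k d" using xC k by (simp add: map_tgt_to)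
  have cx: "composable C n k (unit_to C k n ?z) x"
    using z xC k by (simp add: composable_def dom.src_to_unit_to dom.unit_to_cell)
  have "F n (unit_to C k n ?z) = u" using z k by (simp add: map_unit_to Fz u_def)
  from comp_section_apply[OF cx this xC(2), of "unit_section u" \<sigma>]
  have "comp_section k u (unit_section u) d \<sigma> x = composite T n k (unit_to T k n (p k ?z)) (\<sigma> x)"
    using dom.unit_left[OF xC(1) k] unit_section_apply_to[OF k z] Fz by (simp add: u_def)
  also have "\<dots> = \<sigma> x"
    using \<sigma> x k p.cod.unit_left[of "\<sigma> x" n k] by (simp add: is_section_def)
  finally show "comp_section k u (unit_section u) d \<sigma> x = \<sigma> x" .
qed

lemma comp_section_unit_right:
  assumes k: "k < n" and d: "d \<in> cells D n" and \<sigma>: "is_section d \<sigma>"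
  defines "u \<equiv> unit_to D k n (src_to D n k d)"
  shows "comp_section k d \<sigma> u (unit_section u) = \<sigma>"
proof (rule section_eqI[OF _ \<sigma>])
  have t: "src_to D n k d \<in> cells D k" using d k by (simp add: cod.src_to_cell)
  have c: "composable D n k d u"
    using t d k by (simp add: u_def composable_def cod.tgt_to_unit_to cod.unit_to_cell)
  have e: "composite D n k d u = d" unfolding u_def by (rule cod.unit_right[OF d k])
  show "is_section d (comp_section k d \<sigma> u (unit_section u))"
    using is_section_comp[OF c \<sigma>, of "unit_section u"] is_section_unit_to[OF k t] e
    by (simp add: u_def)
  fix x assume x: "x \<in> fibre d"
  then have xC: "x \<in> cells C n" "F n x = d" by (simp_all add: fibre_def)
  let ?z = "src_to C n k x"
  have z: "?z \<in> cells C k" using xC k by (simp add: dom.src_to_cell)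
  have Fz: "F k ?z = src_to D n k d" using xC k by (simp add: map_src_to)
  have cx: "composable C n k x (unit_to C k n ?z)"
    using z xC k by (simp add: composable_def dom.tgt_to_unit_to dom.unit_to_cell)
  have "F n (unit_to C k n ?z) = u" using z k by (simp add: map_unit_to Fz u_def)
  from comp_section_apply[OF cx xC(2) this, of \<sigma> "unit_section u"]
  have "comp_section k d \<sigma> u (unit_section u) x = composite T n k (\<sigma> x) (unit_to T k n (p k ?z))"
    using dom.unit_right[OF xC(1) k] unit_section_apply_to[OF k z] Fz by (simp add: u_def)
  also have "\<dots> = \<sigma> x"
    using \<sigma> x k p.cod.unit_right[of "\<sigma> x" n k] by (simp add: is_section_def)
  finally show "comp_section k d \<sigma> u (unit_section u) x = \<sigma> x" .
qed

lemma unit_section_comp: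
  assumes m: "n = Suc m" and c: "composable D m k d d'"
  shows "unit_section (unit D m (composite D m k d d')) =
    comp_section k (unit D m d) (unit_section (unit D m d)) (unit D m d') (unit_section (unit D m d'))"
    (is "?l = ?r")
proof (rule section_eqI)
  have dm: "d \<in> cells D m" "d' \<in> cells D m" "k < m" using c by (simp_all add: composable_def)
  have cu: "composable D n k (unit D m d) (unit D m d')"
    using cod.composable_unit_to[OF c, of n] m by simp
  show "is_section (unit D m (composite D m k d d')) ?l"
    by (rule is_section_unit[OF m cod.comp_cell[OF c]])
  show "is_section (unit D m (composite D m k d d')) ?r"
    using is_section_comp[OF cu is_section_unit[OF m dm(1)] is_section_unit[OF m dm(2)]]
      cod.unit_comp[OF c] m by simp
  fix x assume "x \<in> fibre (unit D m (composite D m k d d'))"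
  then have "x \<in> cells C n" "F n x = unit D m (composite D m k d d')" by (simp_all add: fibre_def)
  then obtain z where z: "z \<in> cells C m" "x = unit C m z" "F m z = composite D m k d d'"
    using unit_lift[of x m "composite D m k d d'"] cod.comp_cell[OF c] m by auto
  \<comment> \<open>The lift is made in dimension \<open>m\<close>; the units on its two factors
    then decompose \<open>x\<close>.\<close>
  obtain a b where ab: "composable C m k a b" "z = composite C m k a b" "F m a = d" "F m b = d'"
    using comp_lift[OF z(1) c z(3)] .
  have abm: "a \<in> cells C m" "b \<in> cells C m" using ab(1) by (simp_all add: composable_def)
  have abu: "composable C n k (unit C m a) (unit C m b)"
    using dom.composable_unit_to[OF ab(1), of n] m by simp
  have "?l x = unit T m (p m z)" using unit_section_apply[OF m z(1)] z by simp
  also have "\<dots> = composite T n k (unit T m (p m a)) (unit T m (p m b))"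
    using p.map_comp[OF ab(1)] p.cod.unit_comp[OF p.map_composable[OF ab(1)]] ab(2) m by simp
  also have "\<dots> = ?r (composite C n k (unit C m a) (unit C m b))"
    using comp_section_apply[OF abu, of "unit D m d" "unit D m d'"]
      unit_section_apply[OF m abm(1)] unit_section_apply[OF m abm(2)] ab abm m
    by (simp add: map_unit)
  finally show "?l x = ?r x" using dom.unit_comp[OF ab(1)] z ab m by simp
qed

text \<open>
  Working over the \<open>n\<close>-skeleton of \<open>D\<close>, a cell of dimension \<open>m \<ge> n\<close> is the iterated unit of
  \<open>src_to D m n d\<close>, so a section over that \<open>n\<close>-cell is all the data needed; below dimension \<open>n\<close> the
  sections are given by \<open>p\<close>, and the second component is a dummy.
\<close>

definition section_category :: "('d \<times> ('c \<Rightarrow> 't)) ocat" where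
  "section_category =
     \<lparr>cells = (\<lambda>m. {(d, \<sigma>). d \<in> cells (skel (Suc n) D) m \<and>
        (if m < n then \<sigma> = undefined else is_section (src_to D m n d) \<sigma>)}),
      src = (\<lambda>m (d, \<sigma>). (src D m d, if m < n then undefined else \<sigma>)),
      tgt = (\<lambda>m (d, \<sigma>). (tgt D m d, if m < n then undefined else \<sigma>)),
      unit = (\<lambda>m (d, \<sigma>). (unit D m d, if Suc m < n then undefined
        else if Suc m = n then unit_section (unit D m d) else \<sigma>)),
      composite = (\<lambda>m k (d, \<sigma>) (d', \<sigma>'). (composite D m k d d', if m < n then undefined
        else if k < n then comp_section k (src_to D m n d) \<sigma> (src_to D m n d') \<sigma>' else \<sigma>))\<rparr>"

section \<open>The axioms for the omega-category of sections\<close>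

lemma section_category_simps:
  "(d, \<sigma>) \<in> cells section_category m \<longleftrightarrow> d \<in> cells (skel (Suc n) D) m \<and>
     (if m < n then \<sigma> = undefined else is_section (src_to D m n d) \<sigma>)"
  "src section_category m (d, \<sigma>) = (src D m d, if m < n then undefined else \<sigma>)"
  "tgt section_category m (d, \<sigma>) = (tgt D m d, if m < n then undefined else \<sigma>)"
  "unit section_category m (d, \<sigma>) = (unit D m d, if Suc m < n then undefined
        else if Suc m = n then unit_section (unit D m d) else \<sigma>)"
  "composite section_category m k (d, \<sigma>) (d', \<sigma>') = (composite D m k d d', if m < n then undefined
        else if k < n then comp_section k (src_to D m n d) \<sigma> (src_to D m n d') \<sigma>' else \<sigma>)"
  by (simp_all add: section_category_def)

lemma section_category_src_to:
  "(d, \<sigma>) \<in> cells section_category m \<Longrightarrow> k \<le> m \<Longrightarrow>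
    src_to section_category m k (d, \<sigma>) = (src_to D m k d, if k < n then undefined else \<sigma>)"
proof -
  \<comment> \<open>At \<open>k = m\<close> nothing is discarded, but a cell of dimension below
    \<open>n\<close> carries \<open>undefined\<close> already.\<close>
  have "src_to section_category m k (d, \<sigma>) =
      (src_to D m k d, if k < n \<and> k < m then undefined else \<sigma>)" if "k \<le> m"
    using that by (induction m arbitrary: d \<sigma>) (auto simp: section_category_simps le_Suc_eq)
  then show "(d, \<sigma>) \<in> cells section_category m \<Longrightarrow> k \<le> m \<Longrightarrow>
    src_to section_category m k (d, \<sigma>) = (src_to D m k d, if k < n then undefined else \<sigma>)"
    by (auto simp: section_category_simps)
qed

lemma section_category_tgt_to:
  "(d, \<sigma>) \<in> cells section_category m \<Longrightarrow> k \<le> m \<Longrightarrow>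
    tgt_to section_category m k (d, \<sigma>) = (tgt_to D m k d, if k < n then undefined else \<sigma>)"
proof -
  have "tgt_to section_category m k (d, \<sigma>) =
      (tgt_to D m k d, if k < n \<and> k < m then undefined else \<sigma>)" if "k \<le> m"
    using that by (induction m arbitrary: d \<sigma>) (auto simp: section_category_simps le_Suc_eq)
  then show "(d, \<sigma>) \<in> cells section_category m \<Longrightarrow> k \<le> m \<Longrightarrow>
    tgt_to section_category m k (d, \<sigma>) = (tgt_to D m k d, if k < n then undefined else \<sigma>)"
    by (auto simp: section_category_simps)
qed

lemma section_category_unit_to:
  assumes "k < n \<Longrightarrow> \<sigma> = undefined" "k \<le> m"
  shows "unit_to section_category k m (d, \<sigma>) = (unit_to D k m d,
      if m < n then undefined else if k < n then unit_section (unit_to D k n d) else \<sigma>)"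
  using assms by (induction m) (auto simp: section_category_simps le_Suc_eq)

lemma section_category_composable:
  "composable section_category m k (d, \<sigma>) (d', \<sigma>') \<longleftrightarrow>
    (d, \<sigma>) \<in> cells section_category m \<and> (d', \<sigma>') \<in> cells section_category m \<and>
    composable (skel (Suc n) D) m k d d' \<and> (n \<le> k \<longrightarrow> \<sigma> = \<sigma>')"
  by (auto simp: composable_def section_category_src_to section_category_tgt_to)
    (auto simp: section_category_simps)

text \<open>First components obey the axioms as in the skeleton of \<open>D\<close>. Second
  components are trivial below dimension \<open>n\<close>; from \<open>n\<close> on, composition
  along \<open>k < n\<close> obeys the laws for sections over the base cells
  \<open>src_to D m n d\<close>, and composition along \<open>k \<ge> n\<close> carries the common
  section along.\<close>

lemma section_category_omega_category: "omega_category section_category"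
proof -
  interpret S: omega_category "skel (Suc n) D" by (rule cod.skel_omega_category)
  have SD: "d \<in> cells D m" if "d \<in> cells (skel (Suc n) D) m" for d m
    using that cod.skel_sub by blast
  have cD: "composable D m k d d'" if "composable (skel (Suc n) D) m k d d'" for m k d d'
    using that by (simp add: cod.composable_skel)
  note D_simps = S.src_cell S.tgt_cell S.src_src S.tgt_tgt S.unit_cell S.src_unit S.tgt_unit S.comp_cell
    S.src_comp_top S.tgt_comp_top S.src_comp S.tgt_comp S.unit_comp S.assoc
  note D_simps = D_simps[simplified]
  have base_src: "src_to D m n (src D m d) = src_to D (Suc m) n d" if "n \<le> m" for m d
    using that by simp
  \<comment> \<open>The base cell is taken by sources. For a target this gives the same cell, since
    above dimension \<open>n\<close> the skeleton contains only iterated units.\<close>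
  have base_tgt: "src_to D m n (tgt D m d) = src_to D (Suc m) n d"
    if "n \<le> m" "d \<in> cells (skel (Suc n) D) (Suc m)" for m d
    using that cod.skel_src_to_eq_tgt_to[of d n "Suc m"] cod.src_to_tgt[of d m n] SD[of d "Suc m"]
    by (cases "m = n") auto
  have base_unit: "src_to D (Suc m) n (unit D m d) = src_to D m n d"
    if "n \<le> m" "d \<in> cells (skel (Suc n) D) m" for m d
    using that by (simp add: cod.src_unit SD)
  have base_comp: "src_to D m n (composite D m k d d') =
      composite D n k (src_to D m n d) (src_to D m n d')"
    "composable D n k (src_to D m n d) (src_to D m n d')"
    if "composable (skel (Suc n) D) m k d d'" "k < n" "n \<le> m" for m k d d'
    using cod.src_to_comp_high[OF cD[OF that(1)] that(2,3)] by simp_all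
  have base_comp_high: "src_to D m n (composite D m k d d') = src_to D m n d'"
    "src_to D m n d = src_to D m n d'"
    if c: "composable (skel (Suc n) D) m k d d'" and "n \<le> k" for m k d d'
  proof -
    have "n \<le> m" "d' \<in> cells (skel (Suc n) D) m" "d \<in> cells (skel (Suc n) D) m" "src_to D m k d = tgt_to D m k d'"
      using that by (auto simp: composable_def)
    then show "src_to D m n (composite D m k d d') = src_to D m n d'"
      "src_to D m n d = src_to D m n d'"
      using cod.src_to_comp_low[OF cD[OF c] that(2)] cod.skel_src_to_eq_tgt_to[of d' n m]
        cod.src_to_eq_of_composable[OF cD[OF c], of n] that(2)
      by (cases "k = n"; simp)+
  qed
  note P = section_category_simps section_category_composable
  show ?thesis
  proof (rule omega_category.intro, goal_cases)
    case (1 x m)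
    then show ?case by (cases x) (auto simp: P D_simps base_src simp del: src_to.simps split: if_splits)
  next
    case (2 x m)
    then show ?case by (cases x) (auto simp: P D_simps base_tgt simp del: src_to.simps split: if_splits)
  next
    case (3 x m)
    then show ?case by (cases x) (auto simp: P D_simps)
  next
    case (4 x m)
    then show ?case by (cases x) (auto simp: P D_simps)
  next
    case (5 x m)
    then show ?case
      by (cases x) (auto simp: P D_simps base_unit is_section_unit SD simp del: src_to.simps
        dest: SD split: if_splits intro: is_section_unit[OF sym])
  next
    case (6 x m)
    then show ?case by (cases x) (auto simp: P D_simps)
  next
    case (7 x m)
    then show ?case by (cases x) (auto simp: P D_simps)
  next
    case (8 m k x y)
    then show ?case
      by (cases x; cases y) (auto simp: P D_simps base_comp base_comp_high is_section_comp split: if_splits)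
  next
    case (9 m x y)
    then show ?case by (cases x; cases y) (auto simp: P D_simps)
  next
    case (10 m x y)
    then show ?case by (cases x; cases y) (auto simp: P D_simps)
  next
    case (11 m k x y)
    then show ?case
      by (cases x; cases y) (auto simp: P D_simps base_src simp del: src_to.simps)
  next
    case (12 m k x y)
    then show ?case
      by (cases x; cases y)
        (auto simp: P D_simps base_tgt composable_def[of "skel (Suc n) D"] simp del: src_to.simps)
  next
    case (13 x m k)
    obtain d \<sigma> where x: "x = (d, \<sigma>)" by (cases x)
    have d: "d \<in> cells D m" using 13 x SD by (simp add: P)
    have t: "tgt_to section_category m k x = (tgt_to D m k d, if k < n then undefined else \<sigma>)"
      using 13 section_category_tgt_to[of d \<sigma> m k] x by simp
    have u: "unit_to section_category k m (tgt_to section_category m k x) =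
      (unit_to D k m (tgt_to D m k d), if m < n then undefined
        else if k < n then unit_section (unit_to D k n (tgt_to D m k d)) else \<sigma>)"
      unfolding t using 13 section_category_unit_to[of k _ m] by simp
    have "comp_section k (unit_to D k n (tgt_to D m k d)) (unit_section (unit_to D k n (tgt_to D m k d)))
       (src_to D m n d) \<sigma> = \<sigma>" if "n \<le> m" "k < n"
      using comp_section_unit_left[of k "src_to D m n d" \<sigma>] that 13 x d
      by (simp add: P cod.src_to_cell cod.tgt_to_src_to)
    then show ?case
      using 13 d cod.unit_left[OF d] unfolding u
      by (auto simp: x P cod.src_to_unit_to cod.tgt_to_cell)
  next
    case (14 x m k)
    obtain d \<sigma> where x: "x = (d, \<sigma>)" by (cases x)
    have d: "d \<in> cells D m" using 14 x SD by (simp add: P)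
    have t: "src_to section_category m k x = (src_to D m k d, if k < n then undefined else \<sigma>)"
      using 14 section_category_src_to[of d \<sigma> m k] x by simp
    have u: "unit_to section_category k m (src_to section_category m k x) =
      (unit_to D k m (src_to D m k d), if m < n then undefined
        else if k < n then unit_section (unit_to D k n (src_to D m k d)) else \<sigma>)"
      unfolding t using 14 section_category_unit_to[of k _ m] by simp
    have "comp_section k (src_to D m n d) \<sigma>
       (unit_to D k n (src_to D m k d)) (unit_section (unit_to D k n (src_to D m k d))) = \<sigma>"
      if "n \<le> m" "k < n"
      using comp_section_unit_right[of k "src_to D m n d" \<sigma>] that 14 x d
      by (simp add: P cod.src_to_cell cod.src_to_src_to)
    then show ?case
      using 14 d cod.unit_right[OF d] unfolding u
      by (auto simp: x P cod.src_to_unit_to cod.src_to_cell)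
  next
    case (15 m k x y)
    obtain d \<sigma> d' \<sigma>' where x: "x = (d, \<sigma>)" "y = (d', \<sigma>')" by (cases x, cases y)
    have c: "composable (skel (Suc n) D) m k d d'" using 15 x by (simp add: P)
    then have d: "d \<in> cells (skel (Suc n) D) m" "d' \<in> cells (skel (Suc n) D) m" "k < m"
      by (simp_all add: composable_def)
    show ?case
      using d unit_section_comp[OF _ cD[OF c]] base_unit[OF _ d(1)] base_unit[OF _ d(2)]
        cod.unit_comp[OF cD[OF c]] by (auto simp: P x simp del: src_to.simps)
  next
    case (16 m k x y z)
    obtain d \<sigma> d' \<sigma>' d'' \<sigma>'' where x: "x = (d, \<sigma>)" "y = (d', \<sigma>')" "z = (d'', \<sigma>'')"
      by (cases x, cases y, cases z)
    have c: "composable (skel (Suc n) D) m k d d'" "composable (skel (Suc n) D) m k d' d''"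
      using 16 x by (simp_all add: P)
    show ?case
      using cod.assoc[OF cD[OF c(1)] cD[OF c(2)]] base_comp[OF c(1)] base_comp[OF c(2)]
        comp_section_assoc[of k "src_to D m n d" "src_to D m n d'" "src_to D m n d''" \<sigma> \<sigma>' \<sigma>''] 16
      by (auto simp: P x split: if_splits)
  next
    case (17 l k m x x' y y')
    obtain d \<sigma> d' \<sigma>' where x: "x = (d, \<sigma>)" "x' = (d', \<sigma>')" by (cases x, cases x')
    obtain e \<tau> e' \<tau>' where y: "y = (e, \<tau>)" "y' = (e', \<tau>')" by (cases y, cases y')
    have c: "composable (skel (Suc n) D) m k d d'" "composable (skel (Suc n) D) m k e e'"
      "composable (skel (Suc n) D) m l d e" "composable (skel (Suc n) D) m l d' e'"
      using 17 x y by (simp_all add: P)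
    note cs = c[THEN cD]
    \<comment> \<open>Composition along a dimension below \<open>n\<close> acts on sections, along
      any other it keeps them, so only the second case needs the exchange law for sections.\<close>
    consider "m < n" | "n \<le> m" "k < n" | "n \<le> m" "n \<le> k" "l < n" | "n \<le> m" "n \<le> l"
      by linarith
    then show ?case
    proof cases
      case 1
      then show ?thesis using cod.exchange[OF 17(1) cs] by (simp add: P x y)
    next
      case 2
      then have "l < n" using 17(1) by simp
      then show ?thesis
        using 2 17 cod.exchange[OF 17(1) cs] base_comp[OF c(1)] base_comp[OF c(2)] base_comp[OF c(3)]
          base_comp[OF c(4)] comp_section_exchange[OF 17(1), of "src_to D m n d" "src_to D m n d'"
            "src_to D m n e" "src_to D m n e'" \<sigma> \<sigma>' \<tau> \<tau>']
        by (simp add: P x y)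
    next
      case 3
      then show ?thesis
        using cod.exchange[OF 17(1) cs] base_comp_high[OF c(1)] base_comp_high[OF c(2)]
        by (simp add: P x y)
    next
      case 4
      then show ?thesis using 17 cod.exchange[OF 17(1) cs] by (simp add: P x y)
    qed
  qed
qed

section \<open>Extension of functors over \<open>C\<close> by way of sections\<close>

text \<open>The values of \<open>q\<close> on the cells over a basis element \<open>e\<close> form a
  section \<open>r e\<close>. These data extend over \<open>D\<close> to a functor into
  \<open>section_category\<close>, and evaluating its sections at the cells of \<open>C\<close>
  gives the required extension.\<close>

lemma extension_along_vimage:
  assumes b: "is_basis D n E"
    and q: "\<And>e. e \<in> cells C n \<Longrightarrow> F n e \<in> E \<Longrightarrow> q e \<in> cells T n"
    and q_src: "\<And>e m. e \<in> cells C n \<Longrightarrow> F n e \<in> E \<Longrightarrow> n = Suc m \<Longrightarrow> src T m (q e) = p m (src C m e)"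
    and q_tgt: "\<And>e m. e \<in> cells C n \<Longrightarrow> F n e \<in> E \<Longrightarrow> n = Suc m \<Longrightarrow> tgt T m (q e) = p m (tgt C m e)"
  shows "\<exists>g. functor_below C T (Suc n) g \<and> (\<forall>m<n. \<forall>x\<in>cells C m. g m x = p m x) \<and>
    (\<forall>e\<in>{e \<in> cells C n. F n e \<in> E}. g n e = q e)"
proof -
  have E: "E \<subseteq> cells D n" using b by (simp add: is_basis_def)
  interpret S: omega_category section_category by (rule section_category_omega_category)
  note P = section_category_simps
  have base: "functor_below D section_category n (\<lambda>m d. (d, undefined))"
    by unfold_locales (auto simp: P cod.skel_cells)
  define r where "r e x = (if x \<in> fibre e then q x else undefined)" for e x
  have r: "is_section e (r e)" if e: "e \<in> E" for e
    unfolding is_section_def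
  proof (intro conjI allI impI ballI)
    fix x assume "x \<in> fibre e"
    then have x: "x \<in> cells C n" "F n x \<in> E" "r e x = q x" using e by (simp_all add: r_def fibre_def)
    show "r e x \<in> cells T n" using q x by simp
    fix j assume "j < n"
    then obtain m where m: "n = Suc m" "j \<le> m" by (cases n) auto
    show "src_to T n j (r e x) = p j (src_to C n j x)"
      using x m q_src[OF x(1,2) m(1)] p.map_src_to[of "src C m x" m j] by (simp add: dom.src_cell)
    show "tgt_to T n j (r e x) = p j (tgt_to C n j x)"
      using x m q_tgt[OF x(1,2) m(1)] p.map_tgt_to[of "tgt C m x" m j] by (simp add: dom.tgt_cell)
  qed (simp add: r_def)
  obtain h where h: "functor_below D section_category (Suc n) h"
    "\<And>m d. m < n \<Longrightarrow> d \<in> cells D m \<Longrightarrow> h m d = (d, undefined)" "\<And>e. e \<in> E \<Longrightarrow> h n e = (e, r e)"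
  proof (rule basis_extension[OF b base, where q = "\<lambda>e. (e, r e)"])
    show "(e, r e) \<in> cells section_category n" if "e \<in> E" for e
      using that r E by (auto simp: P cod.skel_cells)
    show "src section_category m (e, r e) = (src D m e, undefined)"
      "tgt section_category m (e, r e) = (tgt D m e, undefined)" if m: "n = Suc m" for e m
    proof -
      have "m < n" using m by simp
      then show "src section_category m (e, r e) = (src D m e, undefined)"
        "tgt section_category m (e, r e) = (tgt D m e, undefined)" by (simp_all add: P)
    qed
  qed (use that in blast)
  interpret h: functor_below D section_category "Suc n" h by fact
  have fst_comp: "fst (composite section_category m k u v) = composite D m k (fst u) (fst v)" for m k u v
    by (cases u; cases v) (simp add: P)
  have fst_ops: "fst (src section_category m u) = src D m (fst u)"
    "fst (tgt section_category m u) = tgt D m (fst u)"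
    "fst (unit section_category m u) = unit D m (fst u)" for m u
    by (cases u; simp add: P)+
  have fst_cell: "fst u \<in> cells D m" if "u \<in> cells section_category m" for u m
    using that cod.skel_sub[of "Suc n" m] by (cases u) (auto simp: P)
  have fh: "functor_below D D (Suc n) (\<lambda>m d. fst (h m d))"
    by unfold_locales
      (simp_all add: h.map_cell fst_cell h.map_src h.map_tgt h.map_unit h.map_comp fst_ops fst_comp)
  have idD: "functor_below D D (Suc n) (\<lambda>m d. d)" by unfold_locales auto
  \<comment> \<open>By uniqueness on the basis, projecting \<open>h\<close> to \<open>D\<close>
    gives the identity, so \<open>h\<close> selects a section over each \<open>n\<close>-cell
    \<open>d\<close> itself.\<close>
  have h_fst: "fst (h n d) = d" if "d \<in> cells D n" for d
    by (rule basis_functor_eqI[OF b cod.omega_category_axioms fh idD _ _ that]) (simp_all add: h)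
  define \<sigma> where "\<sigma> d = snd (h n d)" for d
  have h\<sigma>: "h n d = (d, \<sigma> d)" "is_section d (\<sigma> d)" if "d \<in> cells D n" for d
  proof -
    show *: "h n d = (d, \<sigma> d)" using h_fst[OF that] by (simp add: \<sigma>_def prod_eq_iff)
    show "is_section d (\<sigma> d)" using h.map_cell[OF that] * by (simp add: P)
  qed
  have \<sigma>: "\<sigma> (F n x) x \<in> cells T n" "\<And>j. j < n \<Longrightarrow> src_to T n j (\<sigma> (F n x) x) = p j (src_to C n j x)"
    "\<And>j. j < n \<Longrightarrow> tgt_to T n j (\<sigma> (F n x) x) = p j (tgt_to C n j x)"
    if "x \<in> cells C n" for x
    using h\<sigma>(2)[OF map_cell[OF that]] that by (simp_all add: is_section_def fibre_def)
  have \<sigma>_unit: "\<sigma> (unit D m d) = unit_section (unit D m d)" if m: "Suc m = n" and d: "d \<in> cells D m" for m d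
  proof -
    have "m < n" "unit D m d \<in> cells D n" using m cod.unit_cell[OF d] by auto
    then show ?thesis
      using h.map_unit[OF d] h(2)[OF _ d] h\<sigma>(1)[of "unit D m d"] m by (simp add: P)
  qed
  have \<sigma>_comp: "\<sigma> (composite D n k d d') = comp_section k d (\<sigma> d) d' (\<sigma> d')"
    if c: "composable D n k d d'" for k d d'
  proof -
    have "d \<in> cells D n" "d' \<in> cells D n" "k < n" using c by (simp_all add: composable_def)
    then show ?thesis
      using h.map_comp[OF c] h\<sigma>(1)[of d] h\<sigma>(1)[of d'] h\<sigma>(1)[OF cod.comp_cell[OF c]] by (simp add: P)
  qed
  \<comment> \<open>In dimension \<open>n\<close> this evaluates at \<open>x\<close> the section
    over its own image: the counit of the adjunction.\<close>
  define g where "g m x = (if m < n then p m x else \<sigma> (F m x) x)" for m x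
  have "functor_below C T (Suc n) g"
  proof (unfold_locales, goal_cases)
    case (1 x m)
    then show ?case using p.map_cell \<sigma>(1) by (cases "m = n") (auto simp: g_def)
  next
    case (2 x m)
    then show ?case using p.map_src \<sigma>(2)[of x m] by (cases "Suc m = n") (auto simp: g_def)
  next
    case (3 x m)
    then show ?case using p.map_tgt \<sigma>(3)[of x m] by (cases "Suc m = n") (auto simp: g_def)
  next
    case (4 x m)
    show ?case
    proof (cases "Suc m = n")
      case True
      then show ?thesis
        using 4 \<sigma>_unit[OF True map_cell] unit_section_apply[OF True[symmetric]] map_unit[of x m]
        by (auto simp: g_def)
    next
      case False
      then show ?thesis using 4 p.map_unit by (simp add: g_def)
    qed
  next
    case (5 m k x y)
    show ?case
    proof (cases "m = n")
      case True
      have c: "composable C n k x y" using 5 True by simp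
      show ?thesis
        using \<sigma>_comp[OF map_composable[OF c]] comp_section_apply[OF c refl refl] True
        by (simp add: g_def map_comp[OF c])
    next
      case False
      then show ?thesis using 5 p.map_comp by (simp add: g_def)
    qed
  qed
  moreover have "g n e = q e" if "e \<in> cells C n" "F n e \<in> E" for e
    using that h(3)[of "F n e"] by (simp add: g_def \<sigma>_def r_def fibre_def)
  ultimately show ?thesis by (intro exI[of _ g]) (simp add: g_def)
qed

end

section \<open>Transfer of bases and freeness\<close>

lemma (in conduche) basis_vimage:
  assumes b: "is_basis D n E"
  shows "is_basis C n {x \<in> cells C n. F n x \<in> E}"
proof (rule is_basisI[OF dom.omega_category_axioms])
  show "cells C n \<subseteq> generated C n {x \<in> cells C n. F n x \<in> E}"
    using generated_vimage[OF subsetD[OF basis_generates[OF b cod.omega_category_axioms]]] map_cell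
    by blast
  fix T :: "(nat + 'a + 'a \<times> nat \<times> bool + 'a) list ocat" and p q
  assume p: "functor_below C T n p"
    and q: "\<And>e. e \<in> {x \<in> cells C n. F n x \<in> E} \<Longrightarrow> q e \<in> cells T n"
      "\<And>e m. e \<in> {x \<in> cells C n. F n x \<in> E} \<Longrightarrow> n = Suc m \<Longrightarrow> src T m (q e) = p m (src C m e)"
      "\<And>e m. e \<in> {x \<in> cells C n. F n x \<in> E} \<Longrightarrow> n = Suc m \<Longrightarrow> tgt T m (q e) = p m (tgt C m e)"
  interpret p: functor_below C T n p by fact
  interpret conduche_sections C D F T n p ..
  show "\<exists>h. functor_below C T (Suc n) h \<and> (\<forall>m<n. \<forall>x\<in>cells C m. h m x = p m x) \<and>
      (\<forall>e\<in>{x \<in> cells C n. F n x \<in> E}. h n e = q e)"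
    by (rule extension_along_vimage[OF b]) (use q in auto)
qed auto

theorem theorem1p6p18:
  fixes C :: "'c ocat" and D :: "'d ocat" and F :: "nat \<Rightarrow> 'c \<Rightarrow> 'd"
  assumes "omega_category C" and "omega_category D" and "discrete_conduche C D F"
  shows "(free_omega_category D \<longrightarrow> free_omega_category C) \<and>
         (free_omega_category C \<and> (\<forall>n. F n ` cells C n = cells D n) \<longrightarrow> free_omega_category D)"
proof (intro conjI impI)
  interpret conduche C D F
    using assms(3) by (simp add: conduche_def conduche_axioms_def discrete_conduche_def)
  show "free_omega_category C" if "free_omega_category D"
    using that basis_vimage assms(1) unfolding free_omega_category_def by blast
  assume C: "free_omega_category C \<and> (\<forall>n. F n ` cells C n = cells D n)"
  then obtain E where E: "\<And>n. is_basis C n (E n)" unfolding free_omega_category_def by metis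
  have "is_basis D n {d. indecomposable D n d}" for n
  proof (rule basis_image)
    \<comment> \<open>\<open>F\<close> preserves and reflects indecomposability, so this preimage
      consists of the indecomposables of \<open>C\<close>, which form the given basis.\<close>
    have "{x \<in> cells C n. F n x \<in> {d. indecomposable D n d}} = E n"
      using basis_eq_indecomposables[OF assms(1) E, of n] indecomposable_iff[of _ n] E[of n]
      by (auto simp: is_basis_def)
    then show "is_basis C n {x \<in> cells C n. F n x \<in> {d. indecomposable D n d}}" using E by simp
  qed (use C in \<open>auto simp: indecomposable_def\<close>)
  then show "free_omega_category D" using assms(2) unfolding free_omega_category_def by blast
qed

end
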